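(* Let $X$ be a separable real Banach space. If there exists a Lipschitz retraction from $X$ onto a generating convex flat subset $K\subset X$ with $0\in K$, then $X$ has the bounded approximation property.
   Context: For vectors $e_1,\dots,e_n$ of a Banach space, $[e_i]_{i=1}^n$ denotes their linear span. A subset $C$ of a Banach space $X$ is called generating if the closed linear span of $C$ is $X$. A sequence $\beta=(e_n)_{n\in\mathbb{N}}$ in $X$ is fundamental if its closed linear span is $X$. Let $K\subset X$ be a bounded generating set and $\beta=(e_n)_{n\in\mathbb{N}}\subset \operatorname{span}(K)$ a fundamental sequence of $X$. The heights of $K$ relative to $\beta$ are $$h_n^\beta=\sup\{d(x,[e_i]_{i=1}^n) : x\in K\},\qquad n\in\mathbb{N}.$$ The set $K$ is called $\beta$-flat if there exists $\varepsilon>0$ such that $\liminf_{n} h_n^\beta(3+\varepsilon)^n=0$. The set $K$ is called flat if it is $\beta$-flat for some fundamental sequence $\beta\subset\operatorname{span}(K)$ of $X$; in particular, a flat set is bounded. A Lipschitz retraction from $X$ onto a subset $K$ is a map $R:X\to K$ with $R(x)=x$ for all $x\in K$ for which there is $\lambda>0$ with $\|R(x)-R(y)\|\le\lambda\|x-y\|$ for all $x,y\in X$. $X$ has the bounded approximation property (BAP) if there is a uniformly bounded net $(T_\alpha)$ of finite rank bounded linear operators on $X$ tending strongly (i.e. pointwise in norm) to the identity on $X$. *)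

theory Defs
  imports "HOL-Analysis.Analysis"
begin

definition generating :: "'a::real_normed_vector set \<Rightarrow> bool" where
  "generating C \<longleftrightarrow> closure (span C) = UNIV"

(* Sequences are indexed by the positive integers: the value of e at 0 is never used. *)
definition fundamental :: "(nat \<Rightarrow> 'a::real_normed_vector) \<Rightarrow> bool" where
  "fundamental e \<longleftrightarrow> closure (span (e ` {1..})) = UNIV"

(* A real supremum: it is genuine whenever K is bounded and nonempty, since the
   distance from x to a subspace is at most norm x. *)
definition height :: "(nat \<Rightarrow> 'a::real_normed_vector) \<Rightarrow> 'a set \<Rightarrow> nat \<Rightarrow> real" where
  "height e K n = (SUP x\<in>K. infdist x (span (e ` {1..n})))"

definition beta_flat :: "(nat \<Rightarrow> 'a::real_normed_vector) \<Rightarrow> 'a set \<Rightarrow> bool" where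
  "beta_flat e K \<longleftrightarrow>
     bounded K \<and> generating K \<and> e ` {1..} \<subseteq> span K \<and> fundamental e \<and>
     (\<exists>\<epsilon>>0. liminf (\<lambda>n. ereal (height e K n * (3 + \<epsilon>) ^ n)) = 0)"

definition flat :: "'a::real_normed_vector set \<Rightarrow> bool" where
  "flat K \<longleftrightarrow> (\<exists>e. beta_flat e K)"

definition lipschitz_retraction :: "'a::real_normed_vector set \<Rightarrow> ('a \<Rightarrow> 'a) \<Rightarrow> bool" where
  "lipschitz_retraction K R \<longleftrightarrow>
     R \<in> UNIV \<rightarrow> K \<and> (\<forall>x\<in>K. R x = x) \<and> (\<exists>L>0. L-lipschitz_on UNIV R)"

definition finite_rank :: "('a::real_normed_vector \<Rightarrow>\<^sub>L 'b::real_normed_vector) \<Rightarrow> bool" where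
  "finite_rank T \<longleftrightarrow> (\<exists>B. finite B \<and> range (blinfun_apply T) = span B)"

definition directed_on :: "'i set \<Rightarrow> ('i \<Rightarrow> 'i \<Rightarrow> bool) \<Rightarrow> bool" where
  "directed_on I le \<longleftrightarrow>
     I \<noteq> {} \<and> reflp_on I le \<and> transp_on I le \<and> (\<forall>i\<in>I. \<forall>j\<in>I. \<exists>k\<in>I. le i k \<and> le j k)"

definition net_tendsto ::
    "'i set \<Rightarrow> ('i \<Rightarrow> 'i \<Rightarrow> bool) \<Rightarrow> ('i \<Rightarrow> 'a::real_normed_vector) \<Rightarrow> 'a \<Rightarrow> bool" where
  "net_tendsto I le f l \<longleftrightarrow> (\<forall>\<epsilon>>0. \<exists>i\<in>I. \<forall>j\<in>I. le i j \<longrightarrow> norm (f j - l) < \<epsilon>)"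

definition approximating_net ::
    "'i set \<Rightarrow> ('i \<Rightarrow> 'i \<Rightarrow> bool) \<Rightarrow> ('i \<Rightarrow> 'a::real_normed_vector \<Rightarrow>\<^sub>L 'a) \<Rightarrow> bool" where
  "approximating_net I le T \<longleftrightarrow>
     directed_on I le \<and> (\<forall>i\<in>I. finite_rank (T i)) \<and> (\<exists>M. \<forall>i\<in>I. norm (T i) \<le> M) \<and>
     (\<forall>x. net_tendsto I le (\<lambda>i. blinfun_apply (T i) x) x)"

(* HOL cannot quantify existentially over the type of indices of a net, so a type is fixed here.
   No generality is lost: by approximating_net_imp_BAP below, a net with indices of an
   arbitrary type suffices. *)
definition bounded_approximation_property :: "'a::real_normed_vector itself \<Rightarrow> bool" where
  "bounded_approximation_property (_ :: 'a itself) \<longleftrightarrow>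
     (\<exists>(I :: ('a set \<times> nat) set) le (T :: 'a set \<times> nat \<Rightarrow> 'a \<Rightarrow>\<^sub>L 'a). approximating_net I le T)"

lemma directed_on_finite_upper_bound:
  assumes "directed_on I le" and "finite F" and "\<And>x. x \<in> F \<Longrightarrow> g x \<in> I"
  shows "\<exists>k\<in>I. \<forall>x\<in>F. le (g x) k"
  using assms(2,3)
proof (induction F rule: finite_induct)
  case empty
  then show ?case using assms(1) by (auto simp: directed_on_def)
next
  case (insert a F)
  then obtain k where k: "k \<in> I" "\<forall>x\<in>F. le (g x) k" by auto
  have ga: "g a \<in> I" using insert.prems by simp
  then obtain m where m: "m \<in> I" "le (g a) m" "le k m"
    using assms(1) k(1) by (auto simp: directed_on_def)
  have tr: "transp_on I le" using assms(1) by (simp add: directed_on_def)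
  have "le (g x) m" if "x \<in> F" for x
    using transp_onD[OF tr _ k(1) m(1)] k(2) m(3) insert.prems that by blast
  then show ?case using m by auto
qed

lemma approximating_net_imp_BAP:
  fixes I :: "'i set" and T :: "'i \<Rightarrow> 'a::real_normed_vector \<Rightarrow>\<^sub>L 'a"
  assumes net: "approximating_net I le T"
  shows "bounded_approximation_property TYPE('a)"
proof -
  have dir: "directed_on I le" and fr: "\<And>i. i \<in> I \<Longrightarrow> finite_rank (T i)"
    and lim: "\<And>x. net_tendsto I le (\<lambda>i. blinfun_apply (T i) x) x"
    using net by (auto simp: approximating_net_def)
  obtain M where M: "\<And>i. i \<in> I \<Longrightarrow> norm (T i) \<le> M"
    using net by (auto simp: approximating_net_def)
  have ex: "\<exists>k\<in>I. \<forall>x\<in>F. norm (T k x - x) < inverse (real (Suc n))" if "finite F" for F n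
  proof -
    have "\<forall>x. \<exists>i\<in>I. \<forall>j\<in>I. le i j \<longrightarrow> norm (T j x - x) < inverse (real (Suc n))"
      using lim by (auto simp: net_tendsto_def)
    then obtain g where g: "\<And>x. g x \<in> I"
      "\<And>x j. j \<in> I \<Longrightarrow> le (g x) j \<Longrightarrow> norm (T j x - x) < inverse (real (Suc n))"
      by metis
    show ?thesis
      using directed_on_finite_upper_bound[OF dir that, of g] g by blast
  qed
  define J :: "('a set \<times> nat) set" where "J = {p. finite (fst p)}"
  define le' :: "'a set \<times> nat \<Rightarrow> 'a set \<times> nat \<Rightarrow> bool"
    where "le' p q \<longleftrightarrow> fst p \<subseteq> fst q \<and> snd p \<le> snd q" for p q
  have "\<forall>p. \<exists>k. p \<in> J \<longrightarrow>
      k \<in> I \<and> (\<forall>x\<in>fst p. norm (T k x - x) < inverse (real (Suc (snd p))))"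
    using ex unfolding J_def by blast
  then obtain k where k: "\<And>p. p \<in> J \<Longrightarrow> k p \<in> I"
    "\<And>p x. p \<in> J \<Longrightarrow> x \<in> fst p \<Longrightarrow> norm (T (k p) x - x) < inverse (real (Suc (snd p)))"
    by metis
  have "directed_on J le'"
    unfolding directed_on_def
  proof (intro conjI ballI)
    show "J \<noteq> {}" by (auto simp: J_def intro: exI[of _ "({}, 0)"])
    show "reflp_on J le'" by (auto simp: reflp_on_def le'_def)
    show "transp_on J le'" by (auto simp: transp_on_def le'_def)
    fix p q assume "p \<in> J" "q \<in> J"
    then show "\<exists>r\<in>J. le' p r \<and> le' q r"
      by (intro bexI[of _ "(fst p \<union> fst q, max (snd p) (snd q))"]) (auto simp: J_def le'_def)
  qed
  moreover have "net_tendsto J le' (\<lambda>p. T (k p) x) x" for x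
    unfolding net_tendsto_def
  proof (intro allI impI)
    fix \<epsilon> :: real assume "\<epsilon> > 0"
    then obtain n where n: "inverse (real (Suc n)) < \<epsilon>" using reals_Archimedean by blast
    have "norm (T (k p) x - x) < \<epsilon>" if "p \<in> J" "le' ({x}, n) p" for p
    proof -
      have "norm (T (k p) x - x) < inverse (real (Suc (snd p)))"
        using k(2)[OF that(1)] that(2) by (simp add: le'_def)
      also have "\<dots> \<le> inverse (real (Suc n))"
        using that(2) by (simp add: le'_def)
      finally show ?thesis using n by simp
    qed
    then show "\<exists>i\<in>J. \<forall>j\<in>J. le' i j \<longrightarrow> norm (T (k j) x - x) < \<epsilon>"
      by (intro bexI[of _ "({x}, n)"]) (auto simp: J_def)
  qed
  moreover have "\<exists>M. \<forall>p\<in>J. norm (T (k p)) \<le> M"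
    using M k(1) by blast
  ultimately have "approximating_net J le' (\<lambda>p. T (k p))"
    using fr k(1) unfolding approximating_net_def by blast
  then show ?thesis by (auto simp: bounded_approximation_property_def)
qed

end

theory Submission
  imports Defs "HOL-Library.Function_Algebras"
begin

text \<open>
  Let \<open>R\<close> be an \<open>L\<close>-Lipschitz retraction onto \<open>K\<close>. It suffices to find, for each finite \<open>S \<subseteq> K\<close>, a finite
  rank operator that is the identity on \<open>span S\<close> and whose norm is bounded independently of \<open>S\<close>: such
  operators, directed by inclusion of the sets \<open>S\<close>, converge pointwise to the identity because
  \<open>span K\<close> is dense (\<open>BAP_of_operators_fixing_finite_subsets\<close>).

  Fix \<open>S\<close> and let \<open>F\<close> be the span of \<open>S\<close> and \<open>e\<^sub>1, \<dots>, e\<^sub>n\<close>, so that \<open>K\<close> lies within about the height \<open>h\<^sub>n\<close> of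
  \<open>F\<close> and \<open>d = dim F\<close> exceeds \<open>n\<close> by at most a constant. An operator \<open>T\<close> into \<open>F\<close> is sought. Its norm is, up to a
  constant, the largest norm of the functionals \<open>\<psi>\<^sub>j \<circ> T\<close>, where \<open>\<psi>\<^sub>1, \<dots>, \<psi>\<^sub>N\<close> is a finite family of
  functionals that norms \<open>F\<close> up to a constant. A family attached to a \<open>\<theta>\<close>-net of the unit sphere of
  \<open>F\<close> with \<open>\<theta> < 1\<close> will do, and such a net has at most about \<open>(1 + 2 / \<theta>)^d\<close> points
  (\<open>few_norming_functionals\<close>). This is where the base \<open>3 + \<epsilon>\<close> of the flatness condition comes from.

  By the Hahn-Banach theorem on the space of \<open>N\<close>-tuples of vectors (\<open>operator_extension\<close>), an operator
  \<open>T\<close> with \<open>T = id\<close> on \<open>V = span S\<close> and all \<open>\<psi>\<^sub>j \<circ> T\<close> bounded by \<open>C\<close> exists as soon as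
  a trace inequality holds: if the operator \<open>z = \<Sum>\<^sub>j \<psi>\<^sub>j \<otimes> x\<^sub>j\<close> maps \<open>F\<close> into \<open>V\<close>, then
  \<open>\<bar>tr z\<bar> \<le> C (\<Sum>\<^sub>j \<parallel>x\<^sub>j\<parallel>)\<close>. This involves just the \<open>N\<close> directions \<open>x\<^sub>j\<close> at a time, so the trace
  inequality needs only a linear map \<open>D\<close> on the span of these vectors that fixes those lying in \<open>V\<close>, is bounded by
  \<open>L + 1\<close> on each \<open>x\<^sub>j\<close>, and has \<open>D x\<^sub>j\<close> within a small multiple of \<open>\<parallel>x\<^sub>j\<parallel>\<close> of \<open>F\<close>: then \<open>z = D z\<close>, the
  part of \<open>D z\<close> in \<open>F\<close> has trace at most a constant times \<open>\<Sum>\<^sub>j \<parallel>x\<^sub>j\<parallel>\<close>, and the rest is negligible even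
  after multiplication by \<open>d\<close> (\<open>trace_bound\<close>, using a nearly Auerbach basis of \<open>F\<close>).

  The map \<open>D\<close> is a derivative of \<open>R\<close>, averaged over a box spanned by a basis of \<open>V\<close> consisting of points of \<open>S\<close>
  and by short multiples, of length \<open>r\<close>, of the \<open>x\<^sub>j\<close> (\<open>linearization_fixing_span\<close>). Averaging makes \<open>R\<close>
  differentiable along the box, so \<open>D\<close> is linear; \<open>D x\<^sub>j\<close> is \<open>\<parallel>x\<^sub>j\<parallel> / r\<close> times an average of
  differences of points of \<open>K\<close>, hence within about \<open>h\<^sub>n \<parallel>x\<^sub>j\<parallel> / r\<close> of \<open>F\<close>; and \<open>D\<close> is nearly the identity on \<open>V\<close>
  because the box lies within \<open>N r\<close> of \<open>K\<close>, where \<open>R\<close> is the identity. A correction by a small finite rank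
  operator makes it exactly the identity there. With \<open>r\<close> of order \<open>1 / N\<close> all that is required is that
  \<open>d h\<^sub>n N\<close> be small, which flatness provides for infinitely many \<open>n\<close>.
\<close>

section \<open>Sublinear functionals and the Hahn-Banach theorem\<close>

definition sublinear :: "('a::real_vector \<Rightarrow> real) \<Rightarrow> bool" where
  "sublinear p \<longleftrightarrow> (\<forall>x y. p (x + y) \<le> p x + p y) \<and> (\<forall>c\<ge>0. \<forall>x. p (c *\<^sub>R x) = c * p x)"

lemma sublinear_add: "sublinear p \<Longrightarrow> p (x + y) \<le> p x + p y"
  and sublinear_scale: "sublinear p \<Longrightarrow> 0 \<le> c \<Longrightarrow> p (c *\<^sub>R x) = c * p x"
  by (auto simp: sublinear_def)

lemma sublinear_zero: "sublinear p \<Longrightarrow> p 0 = 0"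
  using sublinear_scale[of p 0 0] by simp

lemma sublinear_ge_uminus: "sublinear p \<Longrightarrow> - p (- x) \<le> p x"
  using sublinear_add[of p x "- x"] sublinear_zero[of p] by simp

lemma sublinearI:
  assumes add: "\<And>x y. p (x + y) \<le> p x + p y" and zero: "p 0 = 0"
    and scale: "\<And>c x. 0 < c \<Longrightarrow> p (c *\<^sub>R x) \<le> c * p x"
  shows "sublinear p"
  unfolding sublinear_def
proof (intro conjI allI impI add)
  fix c :: real and x assume "0 \<le> c"
  show "p (c *\<^sub>R x) = c * p x"
  proof (cases "c = 0")
    case False
    with \<open>0 \<le> c\<close> have c: "0 < c" by simp
    have "p x \<le> (1/c) * p (c *\<^sub>R x)"
      using scale[of "1/c" "c *\<^sub>R x"] c by simp
    then have "c * p x \<le> p (c *\<^sub>R x)" using c by (simp add: field_simps)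
    with scale[OF c] show ?thesis by (simp add: antisym)
  qed (simp add: zero)
qed

text \<open>
  Zorn's lemma, for the pointwise order. The infimum over a chain is finite because \<open>q \<le> p\<close> forces
  \<open>q x \<ge> - p (- x)\<close>, and it is subadditive because two members of a chain have a common minorant in it.
\<close>

lemma minimal_sublinear_below:
  fixes p :: "'a::real_vector \<Rightarrow> real"
  assumes p: "sublinear p"
  obtains q where "sublinear q" "q \<le> p" "\<And>r. sublinear r \<Longrightarrow> r \<le> q \<Longrightarrow> r = q"
proof -
  define A where "A = {q. sublinear q \<and> q \<le> p}"
  have "partial_order_on A (relation_of (\<lambda>a b. b \<le> a) A)"
    by (auto simp: partial_order_on_def preorder_on_def refl_on_def trans_def antisym_def relation_of_def)
  moreover have "\<exists>u\<in>A. \<forall>a\<in>C. u \<le> a" if C: "C \<in> Chains (relation_of (\<lambda>a b. b \<le> a) A)" for C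
  proof (cases "C = {}")
    case True
    then show ?thesis using p by (auto simp: A_def)
  next
    case False
    have CA: "C \<subseteq> A" and chain: "\<And>a b. a \<in> C \<Longrightarrow> b \<in> C \<Longrightarrow> a \<le> b \<or> b \<le> a"
      using C by (auto simp: Chains_def relation_of_def)
    have sub: "sublinear q" and le: "q x \<le> p x" if "q \<in> C" for q x
      using CA that by (auto simp: A_def le_fun_def)
    have lower: "- p (- x) \<le> q x" if "q \<in> C" for q x
      using sublinear_ge_uminus[OF sub[OF that], of x] le[OF that, of "- x"] by simp
    define u where "u x = (INF q\<in>C. q x)" for x
    have bdd: "bdd_below ((\<lambda>q. q x) ` C)" for x
      using lower by (auto intro!: bdd_belowI2)
    have u_le: "u x \<le> q x" if "q \<in> C" for q x
      unfolding u_def using bdd that by (rule cINF_lower)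
    have u_ge: "b \<le> u x" if "\<And>q. q \<in> C \<Longrightarrow> b \<le> q x" for b x
      unfolding u_def using False that by (rule cINF_greatest)
    have "sublinear u"
    proof (rule sublinearI)
      fix x y
      have "u (x + y) \<le> q1 x + q2 y" if q: "q1 \<in> C" "q2 \<in> C" for q1 q2
      proof -
        obtain q where "q \<in> C" "q \<le> q1" "q \<le> q2" using chain[OF q] q by auto
        then show ?thesis
          using u_le[of q "x + y"] sublinear_add[OF sub, of q x y] le_funD[of q q1 x] le_funD[of q q2 y]
          by linarith
      qed
      then have "u (x + y) - u y \<le> q1 x" if "q1 \<in> C" for q1
        using u_ge[of "u (x + y) - q1 x" y] that by (force simp: algebra_simps)
      then show "u (x + y) \<le> u x + u y"
        using u_ge[of "u (x + y) - u y" x] by simp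
    next
      obtain q where q: "q \<in> C" using False by auto
      have "sublinear q" using sub q by auto
      then have "u 0 \<le> 0" using u_le[OF q, of 0] sublinear_zero by metis
      moreover have "0 \<le> u 0"
        by (rule u_ge) (simp add: sub sublinear_zero)
      ultimately show "u 0 = 0" by simp
    next
      fix c :: real and x assume c: "0 < c"
      have "u (c *\<^sub>R x) / c \<le> u x"
      proof (rule u_ge)
        fix q assume q: "q \<in> C"
        have "u (c *\<^sub>R x) \<le> c * q x"
          using u_le[OF q, of "c *\<^sub>R x"] sublinear_scale[OF sub[OF q], of c x] c by simp
        then show "u (c *\<^sub>R x) / c \<le> q x" using c by (simp add: field_simps)
      qed
      then show "u (c *\<^sub>R x) \<le> c * u x" using c by (simp add: field_simps)
    qed
    moreover have "u \<le> p"
      using False u_le le by (metis (mono_tags) equals0I le_funI order_trans)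
    ultimately show ?thesis using u_le by (auto simp: A_def le_fun_def)
  qed
  ultimately obtain q where "q \<in> A" "\<forall>a\<in>A. a \<le> q \<longrightarrow> a = q"
    using predicate_Zorn[of A "\<lambda>a b. b \<le> a"] by blast
  then show ?thesis
    using that[of q] by (auto simp: A_def)
qed

text \<open>
  For a fixed \<open>y\<close>, lowering \<open>q\<close> along the ray through \<open>y\<close> as far as subadditivity permits yields the
  sublinear functional \<open>r z = inf {q (z + t y) - t q y | t \<ge> 0} \<le> q\<close>. By minimality \<open>r = q\<close>, and \<open>t = 1\<close> gives
  \<open>q x + q y \<le> q (x + y)\<close>.
\<close>

lemma minimal_sublinear_linear:
  fixes q :: "'a::real_vector \<Rightarrow> real"
  assumes q: "sublinear q" and min: "\<And>r. sublinear r \<Longrightarrow> r \<le> q \<Longrightarrow> r = q"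
  shows "linear q"
proof -
  have add: "q (x + y) = q x + q y" for x y
  proof -
    define r where "r z = (INF t\<in>{0::real..}. q (z + t *\<^sub>R y) - t * q y)" for z
    have lower: "- q (- z) \<le> q (z + t *\<^sub>R y) - t * q y" if "0 \<le> t" for z t
      using sublinear_add[OF q, of "z + t *\<^sub>R y" "- z"] sublinear_scale[OF q that, of y] by simp
    have r_le: "r z \<le> q (z + t *\<^sub>R y) - t * q y" if "0 \<le> t" for z t
      unfolding r_def using that lower by (intro cINF_lower) (auto intro!: bdd_belowI2)
    have r_ge: "b \<le> r z" if "\<And>t. 0 \<le> t \<Longrightarrow> b \<le> q (z + t *\<^sub>R y) - t * q y" for b z
      unfolding r_def by (rule cINF_greatest) (auto intro: that)
    have "sublinear r"
    proof (rule sublinearI)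
      fix a b
      have *: "r (a + b) \<le> (q (a + s *\<^sub>R y) - s * q y) + (q (b + t *\<^sub>R y) - t * q y)"
        if "0 \<le> s" "0 \<le> t" for s t
        using r_le[of "s + t" "a + b"] that
          sublinear_add[OF q, of "a + s *\<^sub>R y" "b + t *\<^sub>R y"]
        by (simp add: algebra_simps)
      have "r (a + b) - (q (a + s *\<^sub>R y) - s * q y) \<le> r b" if "0 \<le> s" for s
        by (rule r_ge) (use *[OF that] in \<open>simp add: algebra_simps\<close>)
      then have "r (a + b) - r b \<le> r a"
        by (intro r_ge) (simp add: algebra_simps)
      then show "r (a + b) \<le> r a + r b" by simp
    next
      have "r 0 \<le> 0" using r_le[of 0 0] sublinear_zero[OF q] by simp
      moreover have "0 \<le> r 0" by (rule r_ge) (simp add: sublinear_scale[OF q])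
      ultimately show "r 0 = 0" by simp
    next
      fix c :: real and z assume c: "0 < c"
      have "r (c *\<^sub>R z) / c \<le> r z"
      proof (rule r_ge)
        fix t :: real assume "0 \<le> t"
        then have "r (c *\<^sub>R z) \<le> q (c *\<^sub>R (z + t *\<^sub>R y)) - c * t * q y"
          using r_le[of "c * t" "c *\<^sub>R z"] c by (simp add: algebra_simps)
        also have "\<dots> = c * (q (z + t *\<^sub>R y) - t * q y)"
          using sublinear_scale[OF q, of c "z + t *\<^sub>R y"] c by (simp add: algebra_simps)
        finally show "r (c *\<^sub>R z) / c \<le> q (z + t *\<^sub>R y) - t * q y"
          using c by (simp add: field_simps)
      qed
      then show "r (c *\<^sub>R z) \<le> c * r z" using c by (simp add: field_simps)
    qed
    moreover have "r \<le> q" using r_le[of 0] by (auto simp: le_fun_def)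
    ultimately have "r = q" by (rule min)
    then show ?thesis using r_le[of 1 x] sublinear_add[OF q, of x y] by simp
  qed
  have neg: "q (- x) = - q x" for x
    using add[of x "- x"] sublinear_zero[OF q] by simp
  show ?thesis
  proof (rule linearI[OF add])
    fix c x
    show "q (c *\<^sub>R x) = c *\<^sub>R q x"
    proof (cases "0 \<le> c")
      case False
      then show ?thesis using sublinear_scale[OF q, of "- c" x] neg[of "c *\<^sub>R x"] by simp
    qed (simp add: sublinear_scale[OF q])
  qed
qed

text \<open>
  The prescribed functional \<open>g\<close> is built into the majorant: every linear functional below
  \<open>r x = inf {p (x - m) + g m | m \<in> M}\<close> is at most \<open>p\<close> everywhere and at most \<open>g\<close> on the subspace \<open>M\<close>,
  hence equal to \<open>g\<close> there. Such a functional is obtained as a minimal sublinear one.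
\<close>

lemma hahn_banach:
  fixes p g :: "'a::real_vector \<Rightarrow> real"
  assumes p: "sublinear p" and M: "subspace M"
    and g_add: "\<And>x y. x \<in> M \<Longrightarrow> y \<in> M \<Longrightarrow> g (x + y) = g x + g y"
    and g_scale: "\<And>c x. x \<in> M \<Longrightarrow> g (c *\<^sub>R x) = c * g x"
    and g_le: "\<And>x. x \<in> M \<Longrightarrow> g x \<le> p x"
  obtains f where "linear f" "\<And>x. f x \<le> p x" "\<And>x. x \<in> M \<Longrightarrow> f x = g x"
proof -
  have neg: "- x \<in> M" "g (- x) = - g x" if "x \<in> M" for x
    using that subspace_neg[OF M] g_scale[of x "- 1"] by auto
  have g0: "g 0 = 0" using g_scale[of 0 0] subspace_0[OF M] by simp
  define r where "r x = (INF m\<in>M. p (x - m) + g m)" for x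
  have lower: "- p (- x) \<le> p (x - m) + g m" if "m \<in> M" for x m
    using g_le[of "- m"] sublinear_add[OF p, of "x - m" "- x"] neg[OF that] by simp
  have r_le: "r x \<le> p (x - m) + g m" if "m \<in> M" for x m
    unfolding r_def using that lower by (intro cINF_lower) (auto intro!: bdd_belowI2)
  have r_ge: "b \<le> r x" if "\<And>m. m \<in> M \<Longrightarrow> b \<le> p (x - m) + g m" for b x
    unfolding r_def by (rule cINF_greatest) (use subspace_0[OF M] in \<open>auto intro: that\<close>)
  have r: "sublinear r"
  proof (rule sublinearI)
    fix x y
    have *: "r (x + y) \<le> (p (x - m) + g m) + (p (y - n) + g n)" if "m \<in> M" "n \<in> M" for m n
      using r_le[OF subspace_add[OF M that], of "x + y"] g_add[OF that]
        sublinear_add[OF p, of "x - m" "y - n"] by (simp add: algebra_simps)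
    have "r (x + y) - (p (x - m) + g m) \<le> r y" if "m \<in> M" for m
      by (rule r_ge) (use *[OF that] in \<open>simp add: algebra_simps\<close>)
    then have "r (x + y) - r y \<le> r x"
      by (intro r_ge) (simp add: algebra_simps)
    then show "r (x + y) \<le> r x + r y" by simp
  next
    have "r 0 \<le> 0" using r_le[OF subspace_0[OF M], of 0] sublinear_zero[OF p] g0 by simp
    moreover have "0 \<le> r 0"
      by (rule r_ge) (use lower[of _ 0] sublinear_zero[OF p] in simp)
    ultimately show "r 0 = 0" by simp
  next
    fix c :: real and x assume c: "0 < c"
    have "r (c *\<^sub>R x) / c \<le> r x"
    proof (rule r_ge)
      fix m assume m: "m \<in> M"
      have "r (c *\<^sub>R x) \<le> p (c *\<^sub>R (x - m)) + c * g m"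
        using r_le[OF subspace_scale[OF M m], of "c *\<^sub>R x" c] g_scale[OF m, of c]
        by (simp add: algebra_simps)
      also have "\<dots> = c * (p (x - m) + g m)"
        using sublinear_scale[OF p, of c "x - m"] c by (simp add: algebra_simps)
      finally show "r (c *\<^sub>R x) / c \<le> p (x - m) + g m"
        using c by (simp add: field_simps)
    qed
    then show "r (c *\<^sub>R x) \<le> c * r x" using c by (simp add: field_simps)
  qed
  obtain f where f: "sublinear f" "f \<le> r" and min: "\<And>s. sublinear s \<Longrightarrow> s \<le> f \<Longrightarrow> s = f"
    using minimal_sublinear_below[OF r] by blast
  have lin: "linear f" using f(1) min by (rule minimal_sublinear_linear)
  have le: "f x \<le> p (x - m) + g m" if "m \<in> M" for x m
    using f(2) r_le[OF that, of x] by (meson le_funD order_trans)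
  have upper: "f x \<le> g x" if "x \<in> M" for x
    using le[OF that, of x] sublinear_zero[OF p] by simp
  have "f x = g x" if "x \<in> M" for x
    using upper[OF that] upper[OF neg(1)[OF that]] neg(2)[OF that] linear_neg[OF lin, of x] by simp
  moreover have "f x \<le> p x" for x
    using le[OF subspace_0[OF M], of x] g0 by simp
  ultimately show ?thesis using that lin by blast
qed

lemma hahn_banach_norm:
  fixes g :: "'a::real_normed_vector \<Rightarrow> real"
  assumes M: "subspace M" and C: "0 \<le> C"
    and g_add: "\<And>x y. x \<in> M \<Longrightarrow> y \<in> M \<Longrightarrow> g (x + y) = g x + g y"
    and g_scale: "\<And>c x. x \<in> M \<Longrightarrow> g (c *\<^sub>R x) = c * g x"
    and g_le: "\<And>x. x \<in> M \<Longrightarrow> \<bar>g x\<bar> \<le> C * norm x"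
  obtains f where "linear f" "\<And>x. \<bar>f x\<bar> \<le> C * norm x" "\<And>x. x \<in> M \<Longrightarrow> f x = g x"
proof -
  have "sublinear (\<lambda>x::'a. C * norm x)"
    using C by (auto simp: sublinear_def norm_triangle_ineq mult_left_mono
        simp flip: distrib_left)
  then obtain f where f: "linear f" "\<And>x. f x \<le> C * norm x" "\<And>x. x \<in> M \<Longrightarrow> f x = g x"
    using hahn_banach[of "\<lambda>x. C * norm x" M g] M g_add g_scale g_le
    by (metis abs_le_D1)
  have "\<bar>f x\<bar> \<le> C * norm x" for x
    using f(2)[of x] f(2)[of "- x"] linear_neg[OF f(1), of x] by simp
  with f that show ?thesis by blast
qed

lemma norming_functional:
  fixes x :: "'a::real_normed_vector"
  obtains f where "linear f" "\<And>y. \<bar>f y\<bar> \<le> norm y" "f x = norm x"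
proof (cases "x = 0")
  case True
  show ?thesis by (rule that[of "\<lambda>_. 0"]) (auto simp: True linear_iff)
next
  case False
  define g where "g y = (THE c. y = c *\<^sub>R x) * norm x" for y
  have g: "g (c *\<^sub>R x) = c * norm x" for c
    unfolding g_def using False by (subst the_equality[of _ c]) auto
  have span: "\<exists>c. y = c *\<^sub>R x" if "y \<in> span {x}" for y
    using that by (auto simp: span_singleton)
  obtain f where "linear f" "\<And>y. \<bar>f y\<bar> \<le> 1 * norm y" "\<And>y. y \<in> span {x} \<Longrightarrow> f y = g y"
  proof (rule hahn_banach_norm[of "span {x}" 1 g])
    fix y z assume "y \<in> span {x}" "z \<in> span {x}"
    then obtain b c where "y = b *\<^sub>R x" "z = c *\<^sub>R x" using span by blast
    then show "g (y + z) = g y + g z" by (metis g scaleR_left_distrib distrib_right)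
  next
    fix c y assume "y \<in> span {x}"
    then show "g (c *\<^sub>R y) = c * g y" using span g by (metis scaleR_scaleR mult.assoc)
  next
    fix y assume "y \<in> span {x}"
    then show "\<bar>g y\<bar> \<le> 1 * norm y" using span[of y] by (auto simp: g abs_mult)
  qed auto
  then show ?thesis using that[of f] g[of 1] by (simp add: span_base)
qed

section \<open>Nearly Auerbach bases of finite-dimensional subspaces\<close>

text \<open>
  Induction on the size of the independent set. For a new vector \<open>a\<close>, the old functionals give a bounded projection
  with complementary part \<open>Q\<close>; a functional that norms \<open>Q a \<noteq> 0\<close>, composed with \<open>Q\<close>, vanishes on the old
  vectors but not on \<open>a\<close>.
\<close>

lemma biorthogonal_functionals:
  fixes B :: "'a::real_normed_vector set"
  assumes "finite B" "independent B"
  shows "\<exists>f. \<forall>b\<in>B. bounded_linear (f b) \<and> (\<forall>c\<in>B. f b c = (if b = c then 1 else 0 :: real))"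
  using assms
proof (induction B rule: finite_induct)
  case empty
  then show ?case by simp
next
  case (insert a B)
  then have indep: "independent B" and a: "a \<notin> span B"
    by (auto simp: independent_insert)
  obtain f where f: "\<And>b. b \<in> B \<Longrightarrow> bounded_linear (f b)"
    "\<And>b c. b \<in> B \<Longrightarrow> c \<in> B \<Longrightarrow> f b c = (if b = c then 1 else 0 :: real)"
    using insert.IH[OF indep] by blast
  define Q where "Q x = x - (\<Sum>b\<in>B. f b x *\<^sub>R b)" for x
  have Q: "bounded_linear Q"
    unfolding Q_def using f(1)
    by (intro bounded_linear_sub bounded_linear_ident bounded_linear_sum bounded_linear_scaleR_const)
  have QB: "Q c = 0" if "c \<in> B" for c
  proof -
    have "(\<Sum>b\<in>B. f b c *\<^sub>R b) = (\<Sum>b\<in>B. if b = c then c else 0)"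
      by (rule sum.cong) (auto simp: f(2) that)
    then show ?thesis using that insert.hyps(1) by (simp add: Q_def)
  qed
  have "(\<Sum>b\<in>B. f b a *\<^sub>R b) \<in> span B"
    by (intro span_sum span_scale span_base)
  then have Qa: "Q a \<noteq> 0" using a by (auto simp: Q_def)
  obtain \<phi> where \<phi>: "linear \<phi>" "\<And>y. \<bar>\<phi> y\<bar> \<le> norm y" "\<phi> (Q a) = norm (Q a)"
    using norming_functional[of "Q a"] by blast
  have "bounded_linear \<phi>"
    using \<phi>(1,2) by (intro bounded_linear_intro[where K = 1]) (auto simp: linear_iff)
  then have "bounded_linear (\<lambda>x. \<phi> (Q x))"
    using Q by (rule bounded_linear_compose)
  define g where "g x = \<phi> (Q x) * inverse (norm (Q a))" for x
  have g: "bounded_linear g"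
    unfolding g_def by (rule bounded_linear_mult_const) fact
  have g0: "g c = 0" if "c \<in> B" for c
    using QB[OF that] linear_0[OF \<phi>(1)] by (simp add: g_def)
  have ga: "g a = 1"
    using \<phi>(3) Qa by (simp add: g_def)
  define h where "h b = (if b = a then g else (\<lambda>x. f b x - g x * f b a))" for b
  show ?case
  proof (intro exI[of _ h] ballI conjI)
    fix b assume b: "b \<in> insert a B"
    show "bounded_linear (h b)"
      using b g f(1)
      by (auto simp: h_def intro!: bounded_linear_sub bounded_linear_compose[OF bounded_linear_mult_left])
    fix c assume "c \<in> insert a B"
    then show "h b c = (if b = c then 1 else 0)"
      using b insert.hyps(2) by (auto simp: h_def g0 ga f(2))
  qed
qed

text \<open>
  The determinant of the matrix of coordinates \<open>c l (v i)\<close>. The dimension is a number rather than a type,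
  since it varies with the subspace.
\<close>

definition coord_det :: "nat \<Rightarrow> (nat \<Rightarrow> 'a \<Rightarrow> real) \<Rightarrow> (nat \<Rightarrow> 'a) \<Rightarrow> real" where
  "coord_det d c v = (\<Sum>p | p permutes {..<d}. of_int (sign p) * (\<Prod>i<d. c (p i) (v i)))"

lemma coord_det_upd:
  assumes "i < d"
  shows "coord_det d c (v(i := x)) =
    (\<Sum>p | p permutes {..<d}. (of_int (sign p) * (\<Prod>j\<in>{..<d} - {i}. c (p j) (v j))) * c (p i) x)"
  unfolding coord_det_def
proof (rule sum.cong[OF refl])
  fix p
  have "(\<Prod>j<d. c (p j) ((v(i := x)) j)) = c (p i) x * (\<Prod>j\<in>{..<d} - {i}. c (p j) ((v(i := x)) j))"
    using assms by (subst prod.remove[of _ i]) auto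
  also have "(\<Prod>j\<in>{..<d} - {i}. c (p j) ((v(i := x)) j)) = (\<Prod>j\<in>{..<d} - {i}. c (p j) (v j))"
    by (rule prod.cong) auto
  finally show "of_int (sign p) * (\<Prod>j<d. c (p j) ((v(i := x)) j)) =
      (of_int (sign p) * (\<Prod>j\<in>{..<d} - {i}. c (p j) (v j))) * c (p i) x" by simp
qed

lemma coord_det_linear:
  fixes c :: "nat \<Rightarrow> 'a::real_vector \<Rightarrow> real"
  assumes i: "i < d" and c: "\<And>l. l < d \<Longrightarrow> linear (c l)"
  shows "linear (\<lambda>x. coord_det d c (v(i := x)))"
  unfolding coord_det_upd[OF i]
proof (intro linear_compose_sum ballI)
  fix p assume "p \<in> {p. p permutes {..<d}}"
  then have "p i < d" using i permutes_in_image[of p "{..<d}" i] by auto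
  then show "linear (\<lambda>x. (of_int (sign p) * (\<Prod>j\<in>{..<d} - {i}. c (p j) (v j))) * c (p i) x)"
    using c[of "p i"] by (auto simp: linear_iff algebra_simps)
qed

lemma coord_det_repeat:
  assumes ij: "i < d" "j < d" "i \<noteq> j" and v: "v i = v j"
  shows "coord_det d c v = 0"
proof -
  let ?t = "Transposition.transpose i j"
  have t: "?t permutes {..<d}" using ij by (simp add: permutes_swap_id)
  have v_t: "v (?t l) = v l" for l
    using v by (auto simp: Transposition.transpose_def)
  have "coord_det d c v =
      (\<Sum>p | p permutes {..<d}. of_int (sign (p \<circ> ?t)) * (\<Prod>l<d. c ((p \<circ> ?t) l) (v l)))"
    unfolding coord_det_def by (rule sum_permutations_compose_right[OF t])
  also have "\<dots> = (\<Sum>p | p permutes {..<d}. - (of_int (sign p) * (\<Prod>l<d. c (p l) (v l))))"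
  proof (rule sum.cong[OF refl])
    fix p assume "p \<in> {p. p permutes {..<d}}"
    then have p: "permutation p" by (auto simp: permutation_permutes)
    have "sign (p \<circ> ?t) = - sign p"
      using ij(3) p by (simp add: sign_compose sign_swap_id permutation_swap_id)
    moreover have "(\<Prod>l<d. c ((p \<circ> ?t) l) (v l)) = (\<Prod>l<d. c (p l) (v l))"
      using prod.permute[OF t, of "\<lambda>l. c (p l) (v l)"] by (simp add: v_t comp_def)
    ultimately show "of_int (sign (p \<circ> ?t)) * (\<Prod>l<d. c ((p \<circ> ?t) l) (v l)) =
      - (of_int (sign p) * (\<Prod>l<d. c (p l) (v l)))" by simp
  qed
  also have "\<dots> = - coord_det d c v"
    by (simp add: coord_det_def sum_negf)
  finally show ?thesis by simp
qed

lemma coord_det_diagonal: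
  assumes "\<And>l i. l < d \<Longrightarrow> i < d \<Longrightarrow> l \<noteq> i \<Longrightarrow> c l (v i) = 0"
  shows "coord_det d c v = (\<Prod>i<d. c i (v i))"
proof -
  have "coord_det d c v = (\<Sum>p\<in>{id}. of_int (sign p) * (\<Prod>i<d. c (p i) (v i)))"
    unfolding coord_det_def
  proof (rule sum.mono_neutral_right)
    show "\<forall>p\<in>{p. p permutes {..<d}} - {id}. of_int (sign p) * (\<Prod>i<d. c (p i) (v i)) = 0"
    proof
      fix p assume p: "p \<in> {p. p permutes {..<d}} - {id}"
      then obtain i where "p i \<noteq> i" by (auto simp: fun_eq_iff)
      then have "i < d" using p permutes_not_in[of p "{..<d}" i] by auto
      moreover have "p i < d" using p \<open>i < d\<close> permutes_in_image[of p "{..<d}" i] by auto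
      ultimately have "c (p i) (v i) = 0" using assms \<open>p i \<noteq> i\<close> by blast
      with \<open>i < d\<close> show "of_int (sign p) * (\<Prod>i<d. c (p i) (v i)) = 0" by auto
    qed
  qed (auto simp: permutes_id finite_permutations)
  then show ?thesis by (simp add: sign_id)
qed

lemma coord_det_bound:
  assumes "\<And>l i. l < d \<Longrightarrow> i < d \<Longrightarrow> \<bar>c l (v i)\<bar> \<le> A"
  shows "\<bar>coord_det d c v\<bar> \<le> fact d * A ^ d"
proof -
  have "\<bar>coord_det d c v\<bar> \<le> (\<Sum>p | p permutes {..<d}. \<bar>of_int (sign p) * (\<Prod>i<d. c (p i) (v i))\<bar>)"
    unfolding coord_det_def by (rule sum_abs)
  also have "\<dots> \<le> (\<Sum>p | p permutes {..<d}. A ^ d)"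
  proof (rule sum_mono)
    fix p assume "p \<in> {p. p permutes {..<d}}"
    then have "p i < d" if "i < d" for i
      using that permutes_in_image[of p "{..<d}" i] by auto
    then have "(\<Prod>i<d. \<bar>c (p i) (v i)\<bar>) \<le> (\<Prod>i<d. A)"
      using assms by (intro prod_mono) auto
    then show "\<bar>of_int (sign p) * (\<Prod>i<d. c (p i) (v i))\<bar> \<le> A ^ d"
      by (simp add: abs_mult abs_prod sign_def)
  qed
  also have "\<dots> = fact d * A ^ d"
    by (simp add: card_permutations)
  finally show ?thesis .
qed

lemma biorthogonal_expansion:
  fixes b :: "nat \<Rightarrow> 'a::real_vector"
  assumes lin: "\<And>l. l < d \<Longrightarrow> linear (f l)"
    and biorth: "\<And>l m. l < d \<Longrightarrow> m < d \<Longrightarrow> f l (b m) = (if l = m then 1 else 0 :: real)"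
    and x: "x \<in> span (b ` {..<d})"
  shows "x = (\<Sum>l<d. f l x *\<^sub>R b l)"
  using x
proof (induction rule: span_induct_alt)
  case base
  show ?case using linear_0[OF lin] by simp
next
  case (step a x y)
  then obtain m where m: "m < d" "x = b m" by auto
  have "(\<Sum>l<d. f l (a *\<^sub>R x + y) *\<^sub>R b l) = (\<Sum>l<d. (if l = m then a *\<^sub>R b m else 0) + f l y *\<^sub>R b l)"
    using m by (intro sum.cong)
      (auto simp: linear_add[OF lin] linear_scale[OF lin] biorth scaleR_add_left)
  also have "\<dots> = a *\<^sub>R x + y"
    using m step by (simp add: sum.distrib)
  finally show ?case by simp
qed

text \<open>
  An Auerbach basis would have functionals of norm 1. Norm 2 is attainable without compactness, by
  nearly maximising a determinant, and serves equally well here: what matters is that the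
  norms do not grow exponentially with the dimension.
\<close>

locale auerbach_system =
  fixes F :: "'a::real_normed_vector set" and d :: nat
    and b :: "nat \<Rightarrow> 'a" and f :: "nat \<Rightarrow> 'a \<Rightarrow> real"
  assumes F: "subspace F"
    and b_in: "\<And>l. l < d \<Longrightarrow> b l \<in> F"
    and b_le: "\<And>l. l < d \<Longrightarrow> norm (b l) \<le> 1"
    and f_linear: "\<And>l. l < d \<Longrightarrow> linear (f l)"
    and f_le: "\<And>l x. l < d \<Longrightarrow> \<bar>f l x\<bar> \<le> 2 * norm x"
    and biorth: "\<And>l m. l < d \<Longrightarrow> m < d \<Longrightarrow> f l (b m) = (if l = m then 1 else 0)"
    and expand: "\<And>x. x \<in> F \<Longrightarrow> x = (\<Sum>l<d. f l x *\<^sub>R b l)"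

text \<open>
  Among vectors of the unit ball of \<open>span B\<close>, choose \<open>b 0, \<dots>, b (d - 1)\<close> whose determinant exceeds
  half of the supremum in absolute value. By Cramer's rule the coordinate functionals of this basis are the
  quotients \<open>D (b(i := x)) / D b\<close>, which are at most 2 on the unit ball; they extend to the whole space by Hahn-Banach.
\<close>

lemma auerbach_system_exists:
  fixes B :: "'a::real_normed_vector set"
  assumes fin: "finite B" and indep: "independent B"
  shows "\<exists>b f. auerbach_system (span B) (card B) b f"
proof -
  define d where "d = card B"
  obtain e where e: "bij_betw e {..<d} B"
    using bij_betw_from_nat_into_finite[OF fin] d_def by blast
  have eB: "e i \<in> B" if "i < d" for i
    using e that by (auto simp: bij_betw_def)
  obtain h where h: "\<And>b. b \<in> B \<Longrightarrow> bounded_linear (h b)"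
    "\<And>b c. b \<in> B \<Longrightarrow> c \<in> B \<Longrightarrow> h b c = (if b = c then 1 else 0 :: real)"
    using biorthogonal_functionals[OF fin indep] by blast
  define c where "c l = h (e l)" for l
  have c_lin: "linear (c l)" if "l < d" for l
    using h(1)[OF eB[OF that]] by (simp add: c_def bounded_linear.linear)
  have "\<exists>K. \<forall>x. norm (c l x) \<le> norm x * K" if "l < d" for l
    using h(1)[OF eB[OF that]] bounded_linear.bounded unfolding c_def by blast
  then obtain K where K: "\<And>l x. l < d \<Longrightarrow> \<bar>c l x\<bar> \<le> norm x * K l"
    unfolding real_norm_def by metis
  define A where "A = (\<Sum>l<d. \<bar>K l\<bar>)"
  have A: "\<bar>c l x\<bar> \<le> A" if "l < d" "norm x \<le> 1" for l x
  proof -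
    have "\<bar>c l x\<bar> \<le> norm x * \<bar>K l\<bar>"
      using K[OF that(1), of x] mult_left_mono[OF abs_ge_self[of "K l"] norm_ge_zero[of x]] by simp
    also have "\<dots> \<le> 1 * \<bar>K l\<bar>" using that(2) by (rule mult_right_mono) simp
    also have "\<dots> \<le> A" unfolding A_def
      unfolding mult_1 by (rule member_le_sum[of l "{..<d}" "\<lambda>l. \<bar>K l\<bar>"]) (use that in auto)
    finally show ?thesis .
  qed
  define U where "U = {v::nat \<Rightarrow> 'a. \<forall>i<d. v i \<in> span B \<and> norm (v i) \<le> 1}"
  let ?D = "\<lambda>v. coord_det d c v"
  have bdd: "bdd_above ((\<lambda>v. \<bar>?D v\<bar>) ` U)"
    using coord_det_bound[of d c _ A] A by (intro bdd_aboveI2[where M = "fact d * A ^ d"]) (auto simp: U_def)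
  define S where "S = (SUP v\<in>U. \<bar>?D v\<bar>)"
  have S: "\<bar>?D v\<bar> \<le> S" if "v \<in> U" for v
    unfolding S_def using bdd that by (rule cSUP_upper2) simp
  have e0: "e i \<noteq> 0" if "i < d" for i
    using eB[OF that] indep by (metis dependent_zero)
  define v0 where "v0 i = e i /\<^sub>R norm (e i)" for i
  have v0: "v0 \<in> U"
    unfolding U_def v0_def
  proof (intro CollectI allI impI conjI)
    fix i assume i: "i < d"
    show "e i /\<^sub>R norm (e i) \<in> span B" by (intro span_scale span_base eB i)
    show "norm (e i /\<^sub>R norm (e i)) \<le> 1" using e0[OF i] by simp
  qed
  have c_e: "c l (e i) = (if l = i then 1 else 0)" if "l < d" "i < d" for l i
    using h(2)[OF eB[OF that(1)] eB[OF that(2)]] that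
      inj_on_eq_iff[OF bij_betw_imp_inj_on[OF e], of l i] by (simp add: c_def)
  have "?D v0 = (\<Prod>i<d. c i (v0 i))"
    by (rule coord_det_diagonal) (auto simp: v0_def linear_scale[OF c_lin] c_e)
  also have "\<dots> = (\<Prod>i<d. inverse (norm (e i)))"
    by (rule prod.cong) (auto simp: v0_def linear_scale[OF c_lin] c_e)
  also have "\<dots> > 0" using e0 by (intro prod_pos) auto
  finally have "0 < S" using S[OF v0] by linarith
  then have "\<exists>v\<in>U. S / 2 < \<bar>?D v\<bar>"
    using less_cSUP_iff[of U "\<lambda>v. \<bar>?D v\<bar>" "S / 2"] bdd v0 unfolding S_def by auto
  then obtain b where b: "b \<in> U" "S / 2 < \<bar>?D b\<bar>" by blast
  have Db: "?D b \<noteq> 0" using b(2) \<open>0 < S\<close> by auto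
  define g where "g i x = inverse (?D b) * ?D (b(i := x))" for i x
  have g_lin: "linear (g i)" if "i < d" for i
  proof -
    have "linear (\<lambda>x. ?D (b(i := x)))" by (rule coord_det_linear[OF that c_lin])
    then show ?thesis by (simp add: linear_iff g_def algebra_simps)
  qed
  have g_ball: "\<bar>g i x\<bar> \<le> 2" if "i < d" "x \<in> span B" "norm x \<le> 1" for i x
  proof -
    have "b(i := x) \<in> U" using b(1) that by (auto simp: U_def)
    then have "\<bar>?D (b(i := x))\<bar> \<le> 2 * \<bar>?D b\<bar>" using S b(2) by fastforce
    then show ?thesis using Db by (simp add: g_def abs_mult field_simps)
  qed
  have g_norm: "\<bar>g i x\<bar> \<le> 2 * norm x" if "i < d" "x \<in> span B" for i x
  proof (cases "x = 0")
    case True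
    then show ?thesis using linear_0[OF g_lin[OF that(1)]] by simp
  next
    case False
    have "\<bar>g i (x /\<^sub>R norm x)\<bar> \<le> 2"
      using that False by (intro g_ball) (auto intro: span_scale)
    then show ?thesis using False
      by (simp add: linear_scale[OF g_lin[OF that(1)]] abs_mult field_simps)
  qed
  have g_biorth: "g i (b j) = (if i = j then 1 else 0)" if "i < d" "j < d" for i j
  proof (cases "i = j")
    case True
    then show ?thesis using Db by (simp add: g_def)
  next
    case False
    then have "?D (b(i := b j)) = 0"
      using that by (intro coord_det_repeat[of i d j]) auto
    then show ?thesis using False by (simp add: g_def)
  qed
  have "\<exists>f. linear f \<and> (\<forall>x. \<bar>f x\<bar> \<le> 2 * norm x) \<and> (\<forall>x\<in>span B. f x = g i x)" if "i < d" for i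
    using hahn_banach_norm[of "span B" 2 "g i"] g_norm[OF that]
      linear_add[OF g_lin[OF that]] linear_scale[OF g_lin[OF that]]
    by (metis subspace_span real_scaleR_def zero_le_numeral)
  then obtain f where f: "\<And>i. i < d \<Longrightarrow> linear (f i)" "\<And>i x. i < d \<Longrightarrow> \<bar>f i x\<bar> \<le> 2 * norm x"
    "\<And>i x. i < d \<Longrightarrow> x \<in> span B \<Longrightarrow> f i x = g i x"
    by metis
  have bB: "b i \<in> span B" "norm (b i) \<le> 1" if "i < d" for i
    using b(1) that by (auto simp: U_def)
  have f_biorth: "f l (b m) = (if l = m then 1 else 0)" if "l < d" "m < d" for l m
    using f(3) g_biorth bB that by simp
  have b_inj: "inj_on b {..<d}"
    by (rule inj_onI) (metis f_biorth lessThan_iff zero_neq_one)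
  have b_indep: "independent (b ` {..<d})"
  proof (rule independent_if_scalars_zero)
    fix u x assume sum0: "(\<Sum>x\<in>b ` {..<d}. u x *\<^sub>R x) = 0" and "x \<in> b ` {..<d}"
    then obtain l where l: "l < d" "x = b l" by auto
    have "0 = f l (\<Sum>m<d. u (b m) *\<^sub>R b m)"
      using sum0 linear_0[OF f(1)[OF l(1)]] by (simp add: sum.reindex[OF b_inj])
    also have "\<dots> = (\<Sum>m<d. if m = l then u (b l) else 0)"
      unfolding linear_sum[OF f(1)[OF l(1)]]
      by (rule sum.cong) (auto simp: linear_scale[OF f(1)[OF l(1)]] f_biorth l)
    finally show "u x = 0" using l by simp
  qed simp
  have b_span: "b ` {..<d} \<subseteq> span B" using bB by auto
  have "span B \<subseteq> span (b ` {..<d})"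
  proof (rule subsetI, rule ccontr)
    fix x assume x: "x \<in> span B" "x \<notin> span (b ` {..<d})"
    then have "independent (insert x (b ` {..<d}))" using b_indep by (simp add: independent_insertI)
    then have "card (insert x (b ` {..<d})) \<le> d"
      using independent_span_bound[OF fin, of "insert x (b ` {..<d})"] x(1) b_span
      by (simp only: d_def[symmetric] insert_subset simp_thms)
    moreover have "x \<notin> b ` {..<d}" using x(2) span_base[of x "b ` {..<d}"] by auto
    ultimately show False by (simp add: card_image[OF b_inj])
  qed
  then have exp: "x = (\<Sum>l<d. f l x *\<^sub>R b l)" if "x \<in> span B" for x
    using that f(1) f_biorth by (intro biorthogonal_expansion) auto
  have "auerbach_system (span B) d b f"
    by (intro auerbach_system.intro subspace_span bB f(1,2) f_biorth exp; assumption)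
  then show ?thesis by (auto simp: d_def)
qed

section \<open>Packing and norming functionals in finite dimensions\<close>

text \<open>
  Coordinates rounded to a grid of mesh slightly less than \<open>\<sigma> / d\<close> distinguish points at distance \<open>\<sigma>\<close>,
  so a pigeonhole count applies. The constant is far from optimal; only the exponent of
  \<open>1 / \<sigma>\<close> matters below.
\<close>

lemma (in auerbach_system) separated_set_card_bound:
  assumes QF: "Q \<subseteq> F" and Q_le: "\<And>x. x \<in> Q \<Longrightarrow> norm x \<le> \<rho>" and \<rho>: "0 \<le> \<rho>"
    and \<sigma>: "0 < \<sigma>" and sep: "\<And>x y. x \<in> Q \<Longrightarrow> y \<in> Q \<Longrightarrow> x \<noteq> y \<Longrightarrow> \<sigma> \<le> norm (x - y)"
  shows "real (card Q) \<le> ((4 * \<rho> * (real d + 1) + 5 * \<sigma>) / \<sigma>) ^ d"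
proof -
  \<comment> \<open>The reciprocal of the mesh.\<close>
  define k where "k = (real d + 1) / \<sigma>"
  have k: "0 < k" using \<sigma> by (simp add: k_def)
  define key where "key x = (\<lambda>l\<in>{..<d}. \<lfloor>f l x * k\<rfloor>)" for x
  define n where "n = \<lceil>2 * \<rho> * k\<rceil> + 1"
  have "inj_on key Q"
  proof (rule inj_onI, rule ccontr)
    fix x y assume xy: "x \<in> Q" "y \<in> Q" "key x = key y" "x \<noteq> y"
    have small: "\<bar>f l (x - y)\<bar> \<le> 1 / k" if l: "l < d" for l
    proof -
      have "\<lfloor>f l x * k\<rfloor> = \<lfloor>f l y * k\<rfloor>"
        using fun_cong[OF xy(3), of l] l by (simp add: key_def)
      then have "\<bar>f l x * k - f l y * k\<bar> \<le> 1" by linarith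
      then have "\<bar>f l (x - y)\<bar> * k \<le> 1"
        using k by (simp add: linear_diff[OF f_linear[OF l]] flip: left_diff_distrib abs_mult_pos)
      then show ?thesis using k by (simp add: field_simps)
    qed
    have "x - y \<in> F" using xy(1,2) QF subspace_diff[OF F] by blast
    then have "norm (x - y) = norm (\<Sum>l<d. f l (x - y) *\<^sub>R b l)" using expand by metis
    also have "\<dots> \<le> (\<Sum>l<d. 1 / k * 1)"
    proof (rule sum_norm_le)
      fix l assume "l \<in> {..<d}"
      then show "norm (f l (x - y) *\<^sub>R b l) \<le> 1 / k * 1"
        unfolding norm_scaleR using k by (intro mult_mono small b_le) auto
    qed
    also have "\<dots> = real d / k" by simp
    also have "\<dots> < \<sigma>" using \<sigma> by (simp add: k_def field_simps)
    finally show False using sep[OF xy(1,2,4)] by simp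
  qed
  moreover have "key ` Q \<subseteq> (\<Pi>\<^sub>E l\<in>{..<d}. {-n..n})"
  proof (rule image_subsetI)
    fix x assume x: "x \<in> Q"
    show "key x \<in> (\<Pi>\<^sub>E l\<in>{..<d}. {-n..n})"
    proof (rule PiE_I)
      fix l assume l: "l \<in> {..<d}"
      have "\<bar>f l x\<bar> \<le> 2 * \<rho>" using f_le[of l x] Q_le[OF x] l by simp
      then have "\<bar>f l x * k\<bar> \<le> 2 * \<rho> * k" using k by (simp add: abs_mult)
      then have "-n \<le> \<lfloor>f l x * k\<rfloor> \<and> \<lfloor>f l x * k\<rfloor> \<le> n" unfolding n_def by linarith
      then show "key x l \<in> {-n..n}" using l by (simp add: key_def)
    qed (simp add: key_def)
  qed
  ultimately have "card Q \<le> card (\<Pi>\<^sub>E l\<in>{..<d}. {-n..n})"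
    by (intro card_inj_on_le) (auto intro: finite_PiE)
  also have "\<dots> = nat (2 * n + 1) ^ d"
    by (simp add: card_PiE)
  finally have "real (card Q) \<le> real (nat (2 * n + 1)) ^ d" by (metis of_nat_le_iff of_nat_power)
  also have "\<dots> \<le> ((4 * \<rho> * (real d + 1) + 5 * \<sigma>) / \<sigma>) ^ d"
  proof (rule power_mono)
    have "0 \<le> 2 * \<rho> * k" using \<rho> k by simp
    then have "0 \<le> n" "real_of_int n \<le> 2 * \<rho> * k + 2" unfolding n_def by linarith+
    then have "real (nat (2 * n + 1)) \<le> 2 * (2 * \<rho> * k + 2) + 1" by simp
    also have "\<dots> = (4 * \<rho> * (real d + 1) + 5 * \<sigma>) / \<sigma>" using \<sigma> by (simp add: k_def field_simps)
    finally show "real (nat (2 * n + 1)) \<le> (4 * \<rho> * (real d + 1) + 5 * \<sigma>) / \<sigma>" .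
  qed simp
  finally show ?thesis .
qed

text \<open>
  A separated set \<open>P\<close> in the ball generates self-similar ones, consisting of the sums
  \<open>p\<^sub>0 + s p\<^sub>1 + \<dots> + s^(m - 1) p\<^sub>(m - 1)\<close>. Two such sums that first differ at position \<open>i\<close> stay at distance
  at least \<open>s^i (\<theta> - 2 s / (1 - s))\<close>, because the later terms contribute at most \<open>2 s^(i + 1) / (1 - s)\<close>.
\<close>

lemma iterated_separated_set:
  fixes P :: "'a::real_normed_vector set"
  assumes F: "subspace F" and P: "finite P" "P \<subseteq> F" "\<And>p. p \<in> P \<Longrightarrow> norm p \<le> 1"
    and sep: "\<And>p q. p \<in> P \<Longrightarrow> q \<in> P \<Longrightarrow> p \<noteq> q \<Longrightarrow> \<theta> \<le> norm (p - q)"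
    and s: "0 < s" "s < 1" and c: "c = \<theta> - 2 * s / (1 - s)" "0 < c"
  shows "\<exists>Q\<subseteq>F. card Q = card P ^ m \<and> finite Q \<and> (\<forall>x\<in>Q. norm x \<le> 1 / (1 - s)) \<and>
    (\<forall>x\<in>Q. \<forall>y\<in>Q. x \<noteq> y \<longrightarrow> c * s ^ m \<le> norm (x - y))"
proof (induction m)
  case 0
  show ?case
    using s subspace_0[OF F] by (intro exI[of _ "{0}"]) simp
next
  case (Suc m)
  then obtain Q where Q: "Q \<subseteq> F" "card Q = card P ^ m" "finite Q"
    and "\<forall>x\<in>Q. norm x \<le> 1 / (1 - s)"
    and "\<forall>x\<in>Q. \<forall>y\<in>Q. x \<noteq> y \<longrightarrow> c * s ^ m \<le> norm (x - y)" by (elim exE conjE)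
  then have Q_le: "\<And>x. x \<in> Q \<Longrightarrow> norm x \<le> 1 / (1 - s)"
    and Q_sep: "\<And>x y. x \<in> Q \<Longrightarrow> y \<in> Q \<Longrightarrow> x \<noteq> y \<Longrightarrow> c * s ^ m \<le> norm (x - y)" by auto
  define h where "h z = fst z + s *\<^sub>R snd z" for z :: "'a \<times> 'a"
  have h_sep: "c * s ^ Suc m \<le> norm (h z - h w)" if zw: "z \<in> P \<times> Q" "w \<in> P \<times> Q" "z \<noteq> w" for z w
  proof (cases "fst z = fst w")
    case True
    then have "snd z \<noteq> snd w" using zw(3) by (auto simp: prod_eq_iff)
    then have "s * (c * s ^ m) \<le> s * norm (snd z - snd w)"
      using Q_sep zw s by (intro mult_left_mono) auto
    also have "\<dots> = norm (h z - h w)"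
      using True s by (simp add: h_def flip: scaleR_diff_right)
    finally show ?thesis by (simp add: mult_ac)
  next
    case False
    have n: "norm (snd z) \<le> 1 / (1 - s)" "norm (snd w) \<le> 1 / (1 - s)"
      using zw Q_le by auto
    have "norm (s *\<^sub>R (snd w - snd z)) = s * norm (snd w - snd z)" using s by simp
    also have "\<dots> \<le> s * (1 / (1 - s) + 1 / (1 - s))"
      using s n norm_triangle_ineq4[of "snd w" "snd z"] by (intro mult_left_mono) auto
    also have "\<dots> = 2 * s / (1 - s)" by (simp add: field_simps)
    finally have a: "norm (s *\<^sub>R (snd w - snd z)) \<le> 2 * s / (1 - s)" .
    have "h z - h w = (fst z - fst w) - s *\<^sub>R (snd w - snd z)"
      by (simp add: h_def algebra_simps)
    then have "norm (fst z - fst w) - norm (s *\<^sub>R (snd w - snd z)) \<le> norm (h z - h w)"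
      by (metis norm_triangle_ineq2)
    moreover have "\<theta> \<le> norm (fst z - fst w)" using sep False zw by auto
    moreover have "c * s ^ Suc m \<le> c"
      using c(2) s power_le_one[of s "Suc m"] by (simp add: mult_left_le)
    ultimately show ?thesis using a c(1) by linarith
  qed
  have "0 < c * s ^ Suc m" using c s by simp
  then have inj: "inj_on h (P \<times> Q)"
    using h_sep by (intro inj_onI) (metis diff_self norm_zero not_le)
  show ?case
  proof (intro exI[of _ "h ` (P \<times> Q)"] conjI ballI impI)
    show "h ` (P \<times> Q) \<subseteq> F"
      using P(2) Q(1) by (auto simp: h_def intro!: subspace_add[OF F] subspace_scale[OF F])
    show "card (h ` (P \<times> Q)) = card P ^ Suc m"
      using Q(2) by (simp add: card_image[OF inj] card_cartesian_product)
    show "finite (h ` (P \<times> Q))" using P(1) Q(3) by simp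
  next
    fix x assume "x \<in> h ` (P \<times> Q)"
    then obtain p q where "p \<in> P" "q \<in> Q" "x = p + s *\<^sub>R q" by (auto simp: h_def)
    then have "norm x \<le> 1 + s * (1 / (1 - s))"
      using P(3) Q_le s norm_triangle_ineq[of p "s *\<^sub>R q"]
      by (smt (verit) mult_left_mono norm_scaleR)
    also have "\<dots> = 1 / (1 - s)" using s by (simp add: field_simps)
    finally show "norm x \<le> 1 / (1 - s)" .
  next
    fix x y assume "x \<in> h ` (P \<times> Q)" "y \<in> h ` (P \<times> Q)" "x \<noteq> y"
    then show "c * s ^ Suc m \<le> norm (x - y)" using h_sep by blast
  qed
qed

text \<open>
  The usual volume comparison bounds the size of a \<open>\<theta>\<close>-separated subset of the unit ball by
  \<open>(1 + 2 / \<theta>)^d\<close>. The same base is reached without any measure: the \<open>m\<close>-fold self-similar set has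
  \<open>card P ^ m\<close> points at mutual distance of order \<open>s^m\<close>, so the crude count gives
  \<open>card P ^ m \<le> C^d (1 / s)^(m d)\<close> for all \<open>m\<close>, and the constant disappears as \<open>m\<close> grows. The condition
  on \<open>s\<close> says that \<open>1 / s > 1 + 2 / \<theta>\<close>.
\<close>

lemma packing_bound:
  fixes B :: "'a::real_normed_vector set"
  assumes B: "finite B" "independent B"
    and P: "finite P" "P \<subseteq> span B" "\<And>p. p \<in> P \<Longrightarrow> norm p \<le> 1"
    and sep: "\<And>p q. p \<in> P \<Longrightarrow> q \<in> P \<Longrightarrow> p \<noteq> q \<Longrightarrow> \<theta> \<le> norm (p - q)"
    and s: "0 < s" "s < 1" "2 * s / (1 - s) < \<theta>"
  shows "real (card P) \<le> (1 / s) ^ card B"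
proof -
  define d where "d = card B"
  obtain b f where "auerbach_system (span B) d b f"
    using auerbach_system_exists[OF B] unfolding d_def by blast
  then interpret auerbach_system "span B" d b f .
  define c where "c = \<theta> - 2 * s / (1 - s)"
  have c: "0 < c" using s by (simp add: c_def)
  define \<rho> where "\<rho> = 1 / (1 - s)"
  have \<rho>: "0 \<le> \<rho>" using s by (simp add: \<rho>_def)
  define C where "C = (4 * \<rho> * (real d + 1) + 5 * c) / c"
  have C: "0 < C" using c \<rho> by (simp add: C_def add_nonneg_pos)
  have bound: "(real (card P) * s ^ d) ^ m \<le> C ^ d" for m
  proof -
    have "\<exists>Q\<subseteq>span B. card Q = card P ^ m \<and> finite Q \<and> (\<forall>x\<in>Q. norm x \<le> 1 / (1 - s)) \<and>
        (\<forall>x\<in>Q. \<forall>y\<in>Q. x \<noteq> y \<longrightarrow> c * s ^ m \<le> norm (x - y))"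
      by (rule iterated_separated_set[OF subspace_span P sep s(1,2) c_def c])
    then obtain Q where Q: "Q \<subseteq> span B" "card Q = card P ^ m" "\<forall>x\<in>Q. norm x \<le> \<rho>"
      "\<forall>x\<in>Q. \<forall>y\<in>Q. x \<noteq> y \<longrightarrow> c * s ^ m \<le> norm (x - y)"
      unfolding \<rho>_def by (elim exE conjE)
    have cs: "0 < c * s ^ m" "c * s ^ m \<le> c"
      using c s power_le_one[of s m] by (auto simp: mult_left_le)
    have "real (card P) ^ m = real (card Q)" using Q(2) by simp
    also have "\<dots> \<le> ((4 * \<rho> * (real d + 1) + 5 * (c * s ^ m)) / (c * s ^ m)) ^ d"
      using Q by (intro separated_set_card_bound \<rho> cs(1)) auto
    also have "\<dots> \<le> ((4 * \<rho> * (real d + 1) + 5 * c) / (c * s ^ m)) ^ d"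
      using cs \<rho> c by (intro power_mono divide_right_mono) auto
    also have "\<dots> = (C / s ^ m) ^ d" by (simp add: C_def)
    finally have "real (card P) ^ m \<le> C ^ d / (s ^ m) ^ d" by (simp add: power_divide)
    then show ?thesis using s(1)
      by (simp add: power_mult_distrib field_simps flip: power_mult)
  qed
  have "real (card P) * s ^ d \<le> 1"
  proof (rule ccontr)
    assume "\<not> ?thesis"
    then obtain m where "C ^ d < (real (card P) * s ^ d) ^ m"
      using real_arch_pow[of "real (card P) * s ^ d" "C ^ d"] by auto
    with bound[of m] show False by simp
  qed
  then have "real (card P) \<le> 1 / s ^ d" using s(1) by (simp add: pos_le_divide_eq)
  then show ?thesis unfolding d_def power_one_over by (simp add: inverse_eq_divide)
qed

text \<open>
  A \<open>\<theta>\<close>-separated subset of the unit sphere of maximal size is a \<open>\<theta>\<close>-net. A functional that norms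
  the point of the net next to \<open>x / \<parallel>x\<parallel>\<close> loses at most \<open>\<theta>\<close> at \<open>x / \<parallel>x\<parallel>\<close>.
\<close>

lemma few_norming_functionals:
  fixes B :: "'a::real_normed_vector set"
  assumes B: "finite B" "independent B"
    and s: "0 < s" "s < 1" "2 * s / (1 - s) < \<theta>"
  obtains N :: nat and \<psi> :: "nat \<Rightarrow> 'a \<Rightarrow> real" where
    "real N \<le> (1 / s) ^ card B" "\<And>j. j < N \<Longrightarrow> linear (\<psi> j)"
    "\<And>j x. j < N \<Longrightarrow> \<bar>\<psi> j x\<bar> \<le> norm x"
    "\<And>x. x \<in> span B \<Longrightarrow> x \<noteq> 0 \<Longrightarrow> \<exists>j<N. (1 - \<theta>) * norm x \<le> \<psi> j x"
proof -
  define good where "good P \<longleftrightarrow> finite P \<and> P \<subseteq> span B \<and> (\<forall>p\<in>P. norm p = 1) \<and>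
    (\<forall>p\<in>P. \<forall>q\<in>P. p \<noteq> q \<longrightarrow> \<theta> \<le> norm (p - q))" for P :: "'a set"
  have card_le: "real (card P) \<le> (1 / s) ^ card B" if "good P" for P
    using that by (intro packing_bound[OF B _ _ _ _ s]) (auto simp: good_def)
  have nat_le: "card P \<le> nat \<lfloor>(1 / s) ^ card B\<rfloor>" if "good P" for P
    using card_le[OF that] by (simp add: le_nat_floor)
  have "good {}" by (simp add: good_def)
  then obtain P where P: "good P" and max: "\<And>Q. good Q \<Longrightarrow> card Q \<le> card P"
    using ex_has_greatest_nat[of good "{}" card "Suc (nat \<lfloor>(1 / s) ^ card B\<rfloor>)"] nat_le
    by (metis le_imp_less_Suc)
  have fin: "finite P" using P by (simp add: good_def)
  have near: "\<exists>p\<in>P. norm (p - x) < \<theta>" if x: "x \<in> span B" "norm x = 1" for x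
  proof (rule ccontr)
    assume far: "\<not> ?thesis"
    have "0 < 2 * s / (1 - s)" using s by simp
    then have "0 < \<theta>" using s by linarith
    then have "x \<notin> P" using far by force
    moreover have "good (insert x P)"
      using P far x by (auto simp: good_def not_less norm_minus_commute)
    then have "card (insert x P) \<le> card P" by (rule max)
    ultimately show False using fin by simp
  qed
  obtain e where e: "bij_betw e {..<card P} P"
    using bij_betw_from_nat_into_finite[OF fin] by blast
  have "\<exists>g. linear g \<and> (\<forall>y. \<bar>g y\<bar> \<le> norm y) \<and> g x = norm x" for x :: 'a
    using norming_functional[of x] by blast
  then obtain g where g: "\<And>x::'a. linear (g x)" "\<And>x y::'a. \<bar>g x y\<bar> \<le> norm y"
    "\<And>x::'a. g x x = norm x" by metis
  show ?thesis
  proof (rule that[of "card P" "\<lambda>j. g (e j)"])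
    fix x assume x: "x \<in> span B" "x \<noteq> 0"
    define u where "u = x /\<^sub>R norm x"
    have xu: "x = norm x *\<^sub>R u" using x by (simp add: u_def)
    have "u \<in> span B" "norm u = 1" using x by (auto simp: u_def intro: span_scale)
    then obtain p where p: "p \<in> P" "norm (p - u) < \<theta>" using near by blast
    then obtain j where j: "j < card P" "p = e j" using e by (auto simp: bij_betw_def)
    have "g p p = 1" using g(3)[of p] p(1) P by (simp add: good_def)
    moreover have "g p (p - u) \<le> \<theta>" using g(2)[of p "p - u"] p(2) by linarith
    ultimately have "1 - \<theta> \<le> g p u" by (simp add: linear_diff[OF g(1)])
    then have "norm x * (1 - \<theta>) \<le> norm x * g p u" by (rule mult_left_mono) simp
    also have "\<dots> = g p x" by (metis xu linear_scale[OF g(1)] real_scaleR_def)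
    finally show "\<exists>j<card P. (1 - \<theta>) * norm x \<le> g (e j) x" using j by (auto simp: mult.commute)
  qed (use card_le[OF P] g in auto)
qed

section \<open>Smoothing a continuous map by averaging over a box\<close>

text \<open>
  Continuity of the derivative is included because it is what makes directional derivatives additive in the direction.
\<close>

definition has_dir_deriv :: "('a::real_normed_vector \<Rightarrow> 'b::real_normed_vector) \<Rightarrow> 'a \<Rightarrow> ('a \<Rightarrow> 'b) \<Rightarrow> bool" where
  "has_dir_deriv f u g \<longleftrightarrow> continuous_on UNIV g \<and>
    (\<forall>y. ((\<lambda>t. f (y + t *\<^sub>R u)) has_vector_derivative g y) (at 0))"

lemma has_dir_deriv_at:
  assumes "has_dir_deriv f u g"
  shows "((\<lambda>t. f (y + t *\<^sub>R u)) has_vector_derivative g (y + s *\<^sub>R u)) (at s)"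
proof -
  have "((\<lambda>t. t - s) has_vector_derivative 1) (at s)"
    by (auto intro!: derivative_eq_intros)
  moreover have "((\<lambda>t. f ((y + s *\<^sub>R u) + t *\<^sub>R u)) has_vector_derivative g (y + s *\<^sub>R u)) (at (s - s))"
    using assms by (simp add: has_dir_deriv_def)
  ultimately have "((\<lambda>t. f ((y + s *\<^sub>R u) + t *\<^sub>R u)) \<circ> (\<lambda>t. t - s) has_vector_derivative
      1 *\<^sub>R g (y + s *\<^sub>R u)) (at s)"
    by (rule vector_diff_chain_at)
  then show ?thesis by (simp add: comp_def algebra_simps)
qed

lemma has_dir_deriv_zero: "has_dir_deriv f 0 (\<lambda>_. 0)"
  by (simp add: has_dir_deriv_def)

lemma has_dir_deriv_zero_unique:
  assumes "has_dir_deriv f 0 g" shows "g y = 0"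
proof -
  have "((\<lambda>t::real. f y) has_vector_derivative g y) (at 0)"
    using assms by (auto simp: has_dir_deriv_def)
  moreover have "((\<lambda>t::real. f y) has_vector_derivative 0) (at 0)" by simp
  ultimately show ?thesis by (rule vector_derivative_unique_at)
qed

lemma has_dir_deriv_scaleR:
  assumes "has_dir_deriv f u g"
  shows "has_dir_deriv f (c *\<^sub>R u) (\<lambda>y. c *\<^sub>R g y)"
  unfolding has_dir_deriv_def
proof (intro conjI allI)
  show "continuous_on UNIV (\<lambda>y. c *\<^sub>R g y)"
    using assms by (auto simp: has_dir_deriv_def intro: continuous_intros)
  fix y
  have "((\<lambda>t. t * c) has_vector_derivative c) (at 0)"
    by (auto intro!: derivative_eq_intros)
  moreover have "((\<lambda>t. f (y + t *\<^sub>R u)) has_vector_derivative g y) (at (0 * c))"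
    using assms by (simp add: has_dir_deriv_def)
  ultimately have "((\<lambda>t. f (y + t *\<^sub>R u)) \<circ> (\<lambda>t. t * c) has_vector_derivative c *\<^sub>R g y) (at 0)"
    by (rule vector_diff_chain_at)
  then show "((\<lambda>t. f (y + t *\<^sub>R c *\<^sub>R u)) has_vector_derivative c *\<^sub>R g y) (at 0)"
    by (simp add: comp_def)
qed

text \<open>
  The function \<open>H a b = f (y + a u + b v)\<close> has partial derivatives, the second one continuous, so it is
  differentiable at the origin; restrict it to the diagonal.
\<close>

lemma has_dir_deriv_add:
  assumes u: "has_dir_deriv f u g" and v: "has_dir_deriv f v h"
  shows "has_dir_deriv f (u + v) (\<lambda>y. g y + h y)"
  unfolding has_dir_deriv_def
proof (intro conjI allI)
  show "continuous_on UNIV (\<lambda>y. g y + h y)"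
    using u v by (auto simp: has_dir_deriv_def intro: continuous_intros)
  fix y
  let ?H = "\<lambda>a b. f (y + a *\<^sub>R u + b *\<^sub>R v)"
  have h: "continuous_on UNIV h" using v by (simp add: has_dir_deriv_def)
  have "((\<lambda>(a, b). ?H a b) has_derivative
      (\<lambda>(s, t). blinfun_scaleR_left (g y) s + blinfun_scaleR_left (h (y + 0 *\<^sub>R u + 0 *\<^sub>R v)) t))
      (at (0, 0) within UNIV \<times> UNIV)"
  proof (rule has_derivative_partialsI[where fx = "blinfun_scaleR_left (g y)" and
        fy = "\<lambda>a b. blinfun_scaleR_left (h (y + a *\<^sub>R u + b *\<^sub>R v))"])
    show "((\<lambda>a. ?H a 0) has_derivative blinfun_scaleR_left (g y)) (at 0)"
      using u by (simp add: has_dir_deriv_def has_vector_derivative_def)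
    show "((\<lambda>b. ?H a b) has_derivative blinfun_scaleR_left (h (y + a *\<^sub>R u + b *\<^sub>R v))) (at b)" for a b
      using has_dir_deriv_at[OF v, of "y + a *\<^sub>R u" b] by (simp add: has_vector_derivative_def)
    have "continuous_on UNIV (\<lambda>(a, b). blinfun_scaleR_left (h (y + a *\<^sub>R u + b *\<^sub>R v)))"
      unfolding case_prod_beta
      by (intro bounded_linear.continuous_on[OF bounded_linear_blinfun_scaleR_left]
          continuous_on_compose2[OF h] continuous_intros) auto
    then show "continuous (at (0, 0) within UNIV \<times> UNIV)
        (\<lambda>(a, b). blinfun_scaleR_left (h (y + a *\<^sub>R u + b *\<^sub>R v)))"
      by (simp add: continuous_on_eq_continuous_within)
  qed auto
  then have H: "((\<lambda>(a, b). ?H a b) has_derivative (\<lambda>(s, t). s *\<^sub>R g y + t *\<^sub>R h y)) (at (0, 0))"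
    by (simp add: case_prod_beta)
  have "((\<lambda>t::real. (t, t)) has_derivative (\<lambda>t. (t, t))) (at 0)"
    by (intro derivative_intros)
  from has_derivative_compose[OF this] H
  have "((\<lambda>t. ?H t t) has_derivative (\<lambda>t. t *\<^sub>R g y + t *\<^sub>R h y)) (at 0)"
    by fastforce
  then show "((\<lambda>t. f (y + t *\<^sub>R (u + v))) has_vector_derivative g y + h y) (at 0)"
    by (simp add: has_vector_derivative_def algebra_simps)
qed

lemma has_dir_deriv_sum:
  fixes w :: "nat \<Rightarrow> 'a::real_normed_vector"
  assumes "\<And>q. q < m \<Longrightarrow> has_dir_deriv f (w q) (D q)"
  shows "has_dir_deriv f (\<Sum>q<m. c q *\<^sub>R w q) (\<lambda>y. \<Sum>q<m. c q *\<^sub>R D q y)"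
  using assms
proof (induction m)
  case 0
  show ?case by (simp add: has_dir_deriv_zero)
next
  case (Suc m)
  have "has_dir_deriv f (\<Sum>q<m. c q *\<^sub>R w q) (\<lambda>y. \<Sum>q<m. c q *\<^sub>R D q y)"
    by (rule Suc.IH) (simp add: Suc.prems)
  moreover have "has_dir_deriv f (c m *\<^sub>R w m) (\<lambda>y. c m *\<^sub>R D m y)"
    by (rule has_dir_deriv_scaleR) (simp add: Suc.prems)
  ultimately show ?case
    unfolding sum.lessThan_Suc by (rule has_dir_deriv_add)
qed

definition segment_mean :: "'a::real_normed_vector \<Rightarrow> ('a \<Rightarrow> 'b::banach) \<Rightarrow> 'a \<Rightarrow> 'b" where
  "segment_mean w f y = integral {0..1} (\<lambda>t. f (y + t *\<^sub>R w))"

lemma segment_integrable: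
  fixes f :: "'a::real_normed_vector \<Rightarrow> 'b::banach"
  assumes f: "continuous_on UNIV f"
  shows "(\<lambda>t. f (y + t *\<^sub>R w)) integrable_on {a..b::real}"
  by (intro integrable_continuous_interval continuous_on_compose2[OF f] continuous_intros) auto

lemma continuous_segment_mean:
  fixes f :: "'a::real_normed_vector \<Rightarrow> 'b::banach"
  assumes "continuous_on UNIV f"
  shows "continuous_on UNIV (segment_mean w f)"
proof -
  have "continuous_on (UNIV \<times> cbox 0 (1::real)) (\<lambda>(y, t). f (y + t *\<^sub>R w))"
    unfolding case_prod_beta by (intro continuous_on_compose2[OF assms] continuous_intros) auto
  from integral_continuous_on_param[OF this] show ?thesis
    by (simp add: segment_mean_def[abs_def])
qed

lemma has_dir_deriv_segment_mean:
  fixes f :: "'a::real_normed_vector \<Rightarrow> 'b::banach"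
  assumes f: "continuous_on UNIV f" and u: "has_dir_deriv f u g"
  shows "has_dir_deriv (segment_mean w f) u (segment_mean w g)"
  unfolding has_dir_deriv_def
proof (intro conjI allI)
  have g: "continuous_on UNIV g" using u by (simp add: has_dir_deriv_def)
  then show "continuous_on UNIV (segment_mean w g)" by (rule continuous_segment_mean)
  fix y
  have "((\<lambda>x. integral (cbox 0 1) (\<lambda>t. f ((y + t *\<^sub>R w) + x *\<^sub>R u))) has_vector_derivative
      integral (cbox 0 1) (\<lambda>t. g ((y + t *\<^sub>R w) + 0 *\<^sub>R u))) (at 0 within UNIV)"
  proof (rule leibniz_rule_vector_derivative)
    show "((\<lambda>x. f ((y + t *\<^sub>R w) + x *\<^sub>R u)) has_vector_derivative g ((y + t *\<^sub>R w) + x *\<^sub>R u))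
        (at x within UNIV)" for x t
      using has_dir_deriv_at[OF u, of "y + t *\<^sub>R w" x] by simp
    show "(\<lambda>t. f ((y + t *\<^sub>R w) + x *\<^sub>R u)) integrable_on cbox 0 1" for x
      using segment_integrable[OF f, of "y + x *\<^sub>R u" w 0 1] by (simp add: add_ac)
    show "continuous_on (UNIV \<times> cbox 0 1) (\<lambda>(x, t). g ((y + t *\<^sub>R w) + x *\<^sub>R u))"
      unfolding case_prod_beta by (intro continuous_on_compose2[OF g] continuous_intros) auto
  qed auto
  then show "((\<lambda>t. segment_mean w f (y + t *\<^sub>R u)) has_vector_derivative segment_mean w g y) (at 0)"
    by (simp add: segment_mean_def add_ac)
qed

text \<open>
  Along its own direction a segment mean is \<open>\<Phi> (s + 1) - \<Phi> s\<close> for an antiderivative \<open>\<Phi>\<close> of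
  \<open>t \<mapsto> f (y + t w)\<close>. Continuity of \<open>f\<close> thus suffices for differentiability of the mean.
\<close>

lemma has_dir_deriv_segment_mean_self:
  fixes f :: "'a::real_normed_vector \<Rightarrow> 'b::banach"
  assumes f: "continuous_on UNIV f"
  shows "has_dir_deriv (segment_mean w f) w (\<lambda>y. f (y + w) - f y)"
  unfolding has_dir_deriv_def
proof (intro conjI allI)
  show "continuous_on UNIV (\<lambda>y. f (y + w) - f y)"
    using f by (intro continuous_on_diff continuous_on_compose2[OF f, of UNIV "\<lambda>y. y + w"])
      (auto intro: continuous_intros)
  fix y
  have "continuous_on {-1..2::real} (\<lambda>t. f (y + t *\<^sub>R w))"
    by (intro continuous_on_compose2[OF f] continuous_intros) auto
  then obtain \<Phi> where \<Phi>: "\<And>t. t \<in> {-1..2} \<Longrightarrow>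
      (\<Phi> has_vector_derivative f (y + t *\<^sub>R w)) (at t within {-1..2})"
    using antiderivative_continuous by metis
  have \<Phi>_shift: "((\<lambda>t. \<Phi> (s + t)) has_vector_derivative f (y + (s + t) *\<^sub>R w)) (at t within S)"
    if "s + t \<in> {-1..2}" "\<And>x. x \<in> S \<Longrightarrow> s + x \<in> {-1..2}" for s t S
  proof -
    have "((\<lambda>t. s + t) has_vector_derivative 1) (at t within S)"
      by (auto intro!: derivative_eq_intros)
    moreover have "(\<Phi> has_vector_derivative f (y + (s + t) *\<^sub>R w)) (at (s + t) within (\<lambda>t. s + t) ` S)"
      using that by (intro has_vector_derivative_within_subset[OF \<Phi>]) auto
    ultimately have "(\<Phi> \<circ> (\<lambda>t. s + t) has_vector_derivative 1 *\<^sub>R f (y + (s + t) *\<^sub>R w)) (at t within S)"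
      by (rule vector_diff_chain_within)
    then show ?thesis by (simp add: comp_def)
  qed
  have mean: "segment_mean w f (y + s *\<^sub>R w) = \<Phi> (s + 1) - \<Phi> s" if "s \<in> {-1<..<1}" for s
  proof -
    have "((\<lambda>t. f (y + (s + t) *\<^sub>R w)) has_integral \<Phi> (s + 1) - \<Phi> (s + 0)) {0..1}"
      using that by (intro fundamental_theorem_of_calculus \<Phi>_shift) auto
    then show ?thesis
      by (simp add: segment_mean_def integral_unique algebra_simps)
  qed
  have 1: "((\<lambda>s. \<Phi> (1 + s)) has_vector_derivative f (y + (1 + 0) *\<^sub>R w)) (at 0 within {-1<..<1})"
    by (rule \<Phi>_shift) auto
  have 0: "((\<lambda>s. \<Phi> (0 + s)) has_vector_derivative f (y + (0 + 0) *\<^sub>R w)) (at 0 within {-1<..<1})"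
    by (rule \<Phi>_shift) auto
  have "((\<lambda>s. \<Phi> (s + 1) - \<Phi> s) has_vector_derivative f (y + w) - f y) (at 0 within {-1<..<1})"
    using has_vector_derivative_diff[OF 1 0] by (simp add: add_ac)
  moreover have "at 0 within {-1<..<1} = at (0::real)" by (rule at_within_open) auto
  ultimately have "((\<lambda>s. \<Phi> (s + 1) - \<Phi> s) has_vector_derivative f (y + w) - f y) (at 0)"
    by (simp only:)
  then show "((\<lambda>s. segment_mean w f (y + s *\<^sub>R w)) has_vector_derivative f (y + w) - f y) (at 0)"
  proof (rule has_vector_derivative_transform_within_open)
    show "open {-1<..<1::real}" by (rule open_greaterThanLessThan)
    show "\<Phi> (s + 1) - \<Phi> s = segment_mean w f (y + s *\<^sub>R w)" if "s \<in> {-1<..<1}" for s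
      using mean[OF that] by (rule sym)
  qed simp
qed

text \<open>
  Riemann sums over the unit interval are convex combinations of values.
\<close>

lemma integral_in_closed_convex:
  fixes \<phi> :: "real \<Rightarrow> 'b::banach"
  assumes \<phi>: "\<phi> integrable_on {0..1}" and S: "closed S" "convex S"
    and in_S: "\<And>t. t \<in> {0..1} \<Longrightarrow> \<phi> t \<in> S"
  shows "integral {0..1} \<phi> \<in> S"
proof -
  have "integral {0..1} \<phi> \<in> closure S"
    unfolding closure_approachable
  proof (intro allI impI)
    fix e :: real assume "0 < e"
    moreover have "(\<phi> has_integral integral {0..1} \<phi>) (cbox 0 1)"
      using \<phi> by (simp add: has_integral_iff)
    ultimately obtain \<gamma> where \<gamma>: "gauge \<gamma>"
      "\<And>p. p tagged_division_of cbox 0 1 \<Longrightarrow> \<gamma> fine p \<Longrightarrow>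
        norm ((\<Sum>(x, k)\<in>p. Henstock_Kurzweil_Integration.content k *\<^sub>R \<phi> x) - integral {0..1} \<phi>) < e"
      unfolding has_integral by metis
    obtain p where p: "p tagged_division_of cbox 0 (1::real)" "\<gamma> fine p"
      using fine_division_exists[OF \<gamma>(1)] by metis
    have "(\<Sum>z\<in>p. Henstock_Kurzweil_Integration.content (snd z) *\<^sub>R \<phi> (fst z)) \<in> S"
    proof (rule convex_sum[OF _ S(2)])
      show "finite p" using p(1) by auto
      show "(\<Sum>z\<in>p. Henstock_Kurzweil_Integration.content (snd z)) = 1"
        using additive_content_tagged_division[OF p(1)] by (simp add: case_prod_beta)
      fix z assume "z \<in> p"
      then have "fst z \<in> {0..1}"
        using tagged_division_ofD(2,3)[OF p(1), of "fst z" "snd z"] by auto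
      then show "\<phi> (fst z) \<in> S" by (rule in_S)
    qed simp
    then show "\<exists>z\<in>S. dist z (integral {0..1} \<phi>) < e"
      using \<gamma>(2)[OF p] by (auto simp: dist_norm case_prod_beta)
  qed
  then show ?thesis using S(1) by simp
qed

lemma segment_mean_in_closed_convex:
  fixes f :: "'a::real_normed_vector \<Rightarrow> 'b::banach"
  assumes "continuous_on UNIV f" "closed S" "convex S" "\<And>t. t \<in> {0..1} \<Longrightarrow> f (y + t *\<^sub>R w) \<in> S"
  shows "segment_mean w f y \<in> S"
  unfolding segment_mean_def using assms
  by (intro integral_in_closed_convex segment_integrable) auto

text \<open>
  Averages are located only through the closed convex sets that contain the averaged values. This
  one form of control yields norm bounds, closeness to a subspace and closeness to a given vector.
\<close>

definition box_differences_in ::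
    "('a::real_normed_vector \<Rightarrow> 'b::real_normed_vector) \<Rightarrow> (nat \<Rightarrow> 'a) \<Rightarrow> nat \<Rightarrow> 'a \<Rightarrow> 'a \<Rightarrow> 'b set \<Rightarrow> bool" where
  "box_differences_in f w m y v S \<longleftrightarrow> closed S \<and> convex S \<and>
    (\<forall>\<tau>. (\<forall>q<m. \<tau> q \<in> {0..1}) \<longrightarrow>
      f (y + (\<Sum>q<m. \<tau> q *\<^sub>R w q) + v) - f (y + (\<Sum>q<m. \<tau> q *\<^sub>R w q)) \<in> S)"

text \<open>
  \<open>A\<close> is the iterated segment mean of \<open>f\<close> in the directions \<open>w 0, \<dots>, w (m - 1)\<close>. Each averaging step creates
  differentiability along its direction, where the derivative is a mere difference, and preserves the
  derivatives in the earlier directions by differentiation under the integral.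
\<close>

lemma smoothing_over_box:
  fixes f :: "'a::real_normed_vector \<Rightarrow> 'b::banach" and w :: "nat \<Rightarrow> 'a"
  assumes f: "continuous_on UNIV f"
  shows "\<exists>A D. continuous_on UNIV A \<and>
    (\<forall>y v S. box_differences_in f w m y v S \<longrightarrow> A (y + v) - A y \<in> S) \<and>
    (\<forall>q<m. has_dir_deriv A (w q) (D q) \<and>
      (\<forall>y S. box_differences_in f w m y (w q) S \<longrightarrow> D q y \<in> S))"
proof (induction m)
  case 0
  have "f (y + v) - f y \<in> S" if "box_differences_in f w 0 y v S" for y v S
    using that by (simp add: box_differences_in_def)
  then show ?case using f by (intro exI[of _ f]) simp
next
  case (Suc m)
  let ?ok = "box_differences_in f w"
  from Suc.IH obtain A D where A: "continuous_on UNIV A"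
    and A_in': "\<forall>y v S. ?ok m y v S \<longrightarrow> A (y + v) - A y \<in> S"
    and D': "\<forall>q<m. has_dir_deriv A (w q) (D q) \<and> (\<forall>y S. ?ok m y (w q) S \<longrightarrow> D q y \<in> S)"
    by (elim exE conjE)
  have A_in: "A (y + v) - A y \<in> S" if "?ok m y v S" for y v S using A_in' that by simp
  have D: "has_dir_deriv A (w q) (D q)" if "q < m" for q using D' that by simp
  have D_in: "D q y \<in> S" if "q < m" "?ok m y (w q) S" for q y S using D' that by simp
  have ok_step: "?ok m (y + t *\<^sub>R w m) v S" if ok: "?ok (Suc m) y v S" and t: "t \<in> {0..1}" for y v S t
    unfolding box_differences_in_def
  proof (intro conjI allI impI)
    fix \<tau> :: "nat \<Rightarrow> real" assume \<tau>: "\<forall>q<m. \<tau> q \<in> {0..1}"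
    have "\<forall>q<Suc m. (\<tau>(m := t)) q \<in> {0..1}" using \<tau> t by (auto simp: less_Suc_eq)
    moreover have "(\<Sum>q<Suc m. (\<tau>(m := t)) q *\<^sub>R w q) = t *\<^sub>R w m + (\<Sum>q<m. \<tau> q *\<^sub>R w q)"
      by simp
    ultimately have "f (y + (t *\<^sub>R w m + (\<Sum>q<m. \<tau> q *\<^sub>R w q)) + v) -
        f (y + (t *\<^sub>R w m + (\<Sum>q<m. \<tau> q *\<^sub>R w q))) \<in> S"
      using ok unfolding box_differences_in_def by metis
    then show "f (y + t *\<^sub>R w m + (\<Sum>q<m. \<tau> q *\<^sub>R w q) + v) -
        f (y + t *\<^sub>R w m + (\<Sum>q<m. \<tau> q *\<^sub>R w q)) \<in> S"
      by (simp only: add.assoc)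
  qed (use ok in \<open>auto simp: box_differences_in_def\<close>)
  define A' where "A' = segment_mean (w m) A"
  define D' where "D' q = (if q = m then (\<lambda>y. A (y + w m) - A y) else segment_mean (w m) (D q))" for q
  have "continuous_on UNIV A'" unfolding A'_def by (rule continuous_segment_mean[OF A])
  moreover have "A' (y + v) - A' y \<in> S" if "?ok (Suc m) y v S" for y v S
  proof -
    have "A' (y + v) - A' y = integral {0..1} (\<lambda>t. A (y + v + t *\<^sub>R w m) - A (y + t *\<^sub>R w m))"
      unfolding A'_def segment_mean_def
      by (rule Henstock_Kurzweil_Integration.integral_diff[symmetric]) (intro segment_integrable A)+
    also have "\<dots> \<in> S"
    proof (rule integral_in_closed_convex)
      show "(\<lambda>t. A (y + v + t *\<^sub>R w m) - A (y + t *\<^sub>R w m)) integrable_on {0..1}"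
        by (intro integrable_diff segment_integrable A)
      show "closed S" "convex S" using that by (auto simp: box_differences_in_def)
      show "A (y + v + t *\<^sub>R w m) - A (y + t *\<^sub>R w m) \<in> S" if "t \<in> {0..1}" for t
        using A_in[OF ok_step[OF \<open>?ok (Suc m) y v S\<close> that]] by (simp add: add_ac)
    qed
    finally show ?thesis .
  qed
  moreover have "has_dir_deriv A' (w q) (D' q)" if "q < Suc m" for q
    unfolding A'_def D'_def using that D[of q]
    by (auto intro: has_dir_deriv_segment_mean_self has_dir_deriv_segment_mean A)
  moreover have "D' q y \<in> S" if q: "q < Suc m" and ok: "?ok (Suc m) y (w q) S" for q y S
  proof (cases "q = m")
    case True
    then show ?thesis using A_in[OF ok_step[OF ok, of 0]] by (simp add: D'_def)
  next
    case False
    then have "q < m" using q by simp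
    then have "segment_mean (w m) (D q) y \<in> S"
      using D[of q] D_in[of q] ok_step[OF ok] ok
      by (intro segment_mean_in_closed_convex) (auto simp: has_dir_deriv_def box_differences_in_def)
    with False show ?thesis by (simp add: D'_def)
  qed
  ultimately show ?case
    by (intro exI[of _ A'] exI[of _ D'] conjI allI impI; simp)
qed

text \<open>
  The \<open>\<Delta> q\<close> are derivatives at 0 of a single function in the directions \<open>w q\<close>, which explains why they
  satisfy all linear relations among the \<open>w q\<close>, although each of them is just an average of differences of \<open>f\<close>. The
  vectors \<open>w q\<close> may well be linearly dependent; this is the case that matters.
\<close>

lemma averaged_differences:
  fixes f :: "'a::real_normed_vector \<Rightarrow> 'b::banach" and w :: "nat \<Rightarrow> 'a"
  assumes f: "continuous_on UNIV f"
  shows "\<exists>\<Delta>. (\<forall>q<m. \<forall>S. box_differences_in f w m 0 (w q) S \<longrightarrow> \<Delta> q \<in> S) \<and>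
    (\<forall>c. (\<Sum>q<m. c q *\<^sub>R w q) = 0 \<longrightarrow> (\<Sum>q<m. c q *\<^sub>R \<Delta> q) = 0)"
proof -
  obtain A D where *: "\<forall>q<m. has_dir_deriv A (w q) (D q) \<and>
      (\<forall>y S. box_differences_in f w m y (w q) S \<longrightarrow> D q y \<in> S)"
    using smoothing_over_box[OF f, where w = w and m = m] by (elim exE conjE)
  have AD: "has_dir_deriv A (w q) (D q)" if "q < m" for q using * that by simp
  have D: "D q y \<in> S" if "q < m" "box_differences_in f w m y (w q) S" for q y S
    using * that by simp
  have "(\<Sum>q<m. c q *\<^sub>R D q 0) = 0" if "(\<Sum>q<m. c q *\<^sub>R w q) = 0" for c
  proof -
    have "has_dir_deriv A 0 (\<lambda>y. \<Sum>q<m. c q *\<^sub>R D q y)"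
      using has_dir_deriv_sum[of m A w D c, OF AD] that by simp
    then show ?thesis by (rule has_dir_deriv_zero_unique)
  qed
  with D show ?thesis by (intro exI[of _ "\<lambda>q. D q 0"]) simp
qed

section \<open>Linearising a retraction onto a nearly finite-dimensional set\<close>

lemma sum_lessThan_add:
  fixes f :: "nat \<Rightarrow> 'a::comm_monoid_add"
  shows "(\<Sum>q<N + k. f q) = (\<Sum>j<N. f j) + (\<Sum>i<k. f (N + i))"
  by (induction k) (simp_all add: add.assoc)

lemma convex_subunit_combination:
  fixes v :: "nat \<Rightarrow> 'a::real_vector"
  assumes K: "convex K" "0 \<in> K" and v: "\<And>i. i < k \<Longrightarrow> v i \<in> K"
    and t: "\<And>i. i < k \<Longrightarrow> 0 \<le> t i" "(\<Sum>i<k. t i) \<le> 1"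
  shows "(\<Sum>i<k. t i *\<^sub>R v i) \<in> K"
proof -
  define t' where "t' i = (if i < k then t i else 1 - (\<Sum>i<k. t i))" for i
  define v' where "v' i = (if i < k then v i else 0)" for i
  have "(\<Sum>i<Suc k. t' i *\<^sub>R v' i) \<in> K"
    by (rule convex_sum[OF _ K(1)]) (use K(2) v t in \<open>auto simp: t'_def v'_def\<close>)
  then show ?thesis by (simp add: t'_def v'_def)
qed

definition near_subspace :: "'a::real_normed_vector set \<Rightarrow> real \<Rightarrow> 'a set" where
  "near_subspace F h = {z. \<exists>y\<in>F. norm (z - y) \<le> h}"

lemma near_subspaceI: "y \<in> F \<Longrightarrow> norm (z - y) \<le> h \<Longrightarrow> z \<in> near_subspace F h"
  by (auto simp: near_subspace_def)

lemma near_subspace_add: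
  assumes "subspace F" "x \<in> near_subspace F a" "y \<in> near_subspace F b"
  shows "x + y \<in> near_subspace F (a + b)"
proof -
  obtain u v where uv: "u \<in> F" "norm (x - u) \<le> a" "v \<in> F" "norm (y - v) \<le> b"
    using assms(2,3) by (auto simp: near_subspace_def)
  have "norm ((x + y) - (u + v)) \<le> a + b"
    using norm_triangle_mono[OF uv(2,4)] by (simp add: algebra_simps)
  then show ?thesis using subspace_add[OF assms(1) uv(1,3)] by (rule near_subspaceI[rotated])
qed

lemma near_subspace_scaleR:
  assumes "subspace F" "x \<in> near_subspace F a" "\<bar>c\<bar> * a \<le> b"
  shows "c *\<^sub>R x \<in> near_subspace F b"
proof -
  obtain u where u: "u \<in> F" "norm (x - u) \<le> a" using assms(2) by (auto simp: near_subspace_def)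
  have "norm (c *\<^sub>R x - c *\<^sub>R u) = \<bar>c\<bar> * norm (x - u)" by (simp flip: scaleR_diff_right)
  also have "\<dots> \<le> b" using mult_left_mono[OF u(2), of "\<bar>c\<bar>"] assms(3) by simp
  finally show ?thesis using subspace_scale[OF assms(1) u(1)] by (rule near_subspaceI[rotated])
qed

lemma near_subspace_sum:
  fixes k :: nat
  assumes "subspace F" "\<And>i. i < k \<Longrightarrow> x i \<in> near_subspace F a"
  shows "(\<Sum>i<k. x i) \<in> near_subspace F (real k * a)"
  using assms(2)
proof (induction k)
  case 0
  show ?case using subspace_0[OF assms(1)] by (auto simp: near_subspace_def)
next
  case (Suc k)
  then have "(\<Sum>i<k. x i) + x k \<in> near_subspace F (real k * a + a)"
    by (intro near_subspace_add assms(1)) auto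
  then show ?case by (simp add: algebra_simps)
qed

lemma convex_near_subspace:
  assumes F: "subspace F"
  shows "convex (near_subspace F h)"
proof (rule convexI)
  fix x y and u v :: real
  assume xy: "x \<in> near_subspace F h" "y \<in> near_subspace F h" and uv: "0 \<le> u" "0 \<le> v" "u + v = 1"
  have "u *\<^sub>R x + v *\<^sub>R y \<in> near_subspace F (u * h + v * h)"
    using xy uv by (intro near_subspace_add near_subspace_scaleR[of F _ h] F) auto
  then show "u *\<^sub>R x + v *\<^sub>R y \<in> near_subspace F h"
    using uv(3) by (simp flip: distrib_right)
qed

lemma closure_near_subspace:
  assumes "z \<in> closure (near_subspace F a)" "a < b"
  shows "z \<in> near_subspace F b"
proof -
  obtain x where x: "x \<in> near_subspace F a" "dist x z < b - a"
    using assms by (meson closure_approachable diff_gt_0_iff_gt)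
  then obtain y where y: "y \<in> F" "norm (x - y) \<le> a" by (auto simp: near_subspace_def)
  have "norm (z - y) \<le> norm (x - y) + norm (z - x)"
    using norm_triangle_ineq[of "x - y" "z - x"] by simp
  then have "norm (z - y) \<le> b" using x(2) y(2) by (simp add: dist_norm norm_minus_commute)
  with y(1) show ?thesis by (rule near_subspaceI)
qed

locale retraction_near_subspace =
  fixes K F :: "'a::banach set" and R :: "'a \<Rightarrow> 'a" and L h :: real
  assumes K: "convex K" "0 \<in> K"
    and R_in: "\<And>x. R x \<in> K" and R_id: "\<And>x. x \<in> K \<Longrightarrow> R x = x"
    and R_lip: "L-lipschitz_on UNIV R"
    and F: "subspace F" and h: "0 < h" and near: "K \<subseteq> near_subspace F h"
begin

lemma lambda_nonneg: "0 \<le> L"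
  using R_lip by (rule lipschitz_on_nonneg)

lemma R_norm: "norm (R x - R y) \<le> L * norm (x - y)"
  using lipschitz_onD[OF R_lip, of x y] by (simp add: dist_norm)

text \<open>
  The averaged derivative of \<open>R\<close> over the box with edges \<open>r x\<^sub>j / \<parallel>x\<^sub>j\<parallel>\<close> and \<open>v\<^sub>i / (2 k)\<close>, as a linear map
  with values \<open>D j\<close> at \<open>x j\<close> and \<open>E i\<close> at \<open>v i\<close>; linearity is expressed by the last clause. Being
  rescaled averages of differences of points of \<open>K\<close>, these values are close to \<open>F\<close>. The box
  stays within \<open>N r\<close> of \<open>K\<close>, where \<open>R\<close> moves points very little, so \<open>E i\<close> is close to \<open>v i\<close>.
\<close>

lemma averaged_derivatives:
  fixes v x :: "nat \<Rightarrow> 'a" and k N :: nat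
  assumes v: "\<And>i. i < k \<Longrightarrow> v i \<in> K" and r: "0 < r"
  shows "\<exists>D E. (\<forall>j<N. norm (D j) \<le> L * norm (x j) \<and> D j \<in> near_subspace F (3 * h / r * norm (x j))) \<and>
    (\<forall>i<k. norm (E i - v i) \<le> 4 * real k * L * real N * r \<and> E i \<in> near_subspace F (6 * real k * h)) \<and>
    (\<forall>a c. (\<Sum>j<N. a j *\<^sub>R x j) = (\<Sum>i<k. c i *\<^sub>R v i) \<longrightarrow>
      (\<Sum>j<N. a j *\<^sub>R D j) = (\<Sum>i<k. c i *\<^sub>R E i))"
proof -
  \<comment> \<open>The factor \<open>1 / (2 k)\<close> leaves room for one further step \<open>w (N + i)\<close> from any point of the box inside \<open>K\<close>.\<close>
  define w where "w q = (if q < N then (r / norm (x q)) *\<^sub>R x q else (1 / (2 * real k)) *\<^sub>R v (q - N))" for q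
  have w_x: "w j = (r / norm (x j)) *\<^sub>R x j" if "j < N" for j using that by (simp add: w_def)
  have w_v: "w (N + i) = (1 / (2 * real k)) *\<^sub>R v i" for i by (simp add: w_def)
  have w_norm: "norm (w j) \<le> r" if "j < N" for j using r by (simp add: w_x[OF that])
  have R_cont: "continuous_on UNIV R" using R_lip by (rule lipschitz_on_continuous_on)
  obtain \<Delta> where \<Delta>: "\<forall>q<N + k. \<forall>S. box_differences_in R w (N + k) 0 (w q) S \<longrightarrow> \<Delta> q \<in> S"
    and rel: "\<forall>c. (\<Sum>q<N + k. c q *\<^sub>R w q) = 0 \<longrightarrow> (\<Sum>q<N + k. c q *\<^sub>R \<Delta> q) = 0"
    using averaged_differences[OF R_cont, where w = w and m = "N + k"] by (elim exE conjE)
  have \<Delta>_in: "\<Delta> q \<in> S" if "q < N + k" "closed S" "convex S"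
    and "\<And>\<tau>. (\<And>q. q < N + k \<Longrightarrow> 0 \<le> \<tau> q \<and> \<tau> q \<le> 1) \<Longrightarrow>
      R ((\<Sum>q<N + k. \<tau> q *\<^sub>R w q) + w q) - R (\<Sum>q<N + k. \<tau> q *\<^sub>R w q) \<in> S" for q S
    using \<Delta> that unfolding box_differences_in_def by simp
  have \<Delta>_norm: "norm (\<Delta> q) \<le> L * norm (w q)" if q: "q < N + k" for q
  proof -
    have "\<Delta> q \<in> cball 0 (L * norm (w q))"
    proof (rule \<Delta>_in[OF q])
      fix \<tau>
      show "R ((\<Sum>q<N + k. \<tau> q *\<^sub>R w q) + w q) - R (\<Sum>q<N + k. \<tau> q *\<^sub>R w q) \<in> cball 0 (L * norm (w q))"
        using R_norm[of "(\<Sum>q<N + k. \<tau> q *\<^sub>R w q) + w q" "\<Sum>q<N + k. \<tau> q *\<^sub>R w q"] by simp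
    qed auto
    then show ?thesis by simp
  qed
  \<comment> \<open>The bound \<open>3 h\<close> instead of \<open>2 h\<close> absorbs the passage to the closure.\<close>
  have \<Delta>_near: "\<Delta> q \<in> near_subspace F (3 * h)" if q: "q < N + k" for q
  proof -
    have "\<Delta> q \<in> closure (near_subspace F (2 * h))"
    proof (rule \<Delta>_in[OF q])
      have "R y - R z \<in> near_subspace F (2 * h)" for y z
      proof -
        have R_near: "R u \<in> near_subspace F h" for u
          using near R_in[of u] by (rule subsetD)
        have "- 1 *\<^sub>R R z \<in> near_subspace F h"
          by (rule near_subspace_scaleR[OF F R_near]) simp
        from near_subspace_add[OF F R_near this] show ?thesis by simp
      qed
      then show "R y - R z \<in> closure (near_subspace F (2 * h))" for y z
        using closure_subset by fast
      show "convex (closure (near_subspace F (2 * h)))"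
        by (intro convex_closure convex_near_subspace F)
    qed simp
    then show ?thesis by (rule closure_near_subspace) (use h in simp)
  qed
  have \<Delta>_v: "norm (\<Delta> (N + i) - w (N + i)) \<le> 2 * L * real N * r" if i: "i < k" for i
  proof -
    have "\<Delta> (N + i) \<in> cball (w (N + i)) (2 * L * real N * r)"
    proof (rule \<Delta>_in)
      fix \<tau> assume \<tau>: "\<And>q. q < N + k \<Longrightarrow> 0 \<le> \<tau> q \<and> \<tau> q \<le> (1::real)"
      \<comment> \<open>A point of the box is a point \<open>s2\<close> of \<open>K\<close> plus a perturbation \<open>s1\<close> of norm at most \<open>N r\<close>.\<close>
      define s1 where "s1 = (\<Sum>j<N. \<tau> j *\<^sub>R w j)"
      define s2 where "s2 = (\<Sum>i<k. (\<tau> (N + i) / (2 * real k)) *\<^sub>R v i)"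
      have s: "(\<Sum>q<N + k. \<tau> q *\<^sub>R w q) = s1 + s2"
        unfolding sum_lessThan_add s1_def s2_def w_v by simp
      have "norm s1 \<le> (\<Sum>j<N. r)"
        unfolding s1_def
      proof (rule sum_norm_le)
        fix j assume "j \<in> {..<N}"
        then have "\<bar>\<tau> j\<bar> * norm (w j) \<le> 1 * r" using \<tau>[of j] w_norm[of j] by (intro mult_mono) auto
        then show "norm (\<tau> j *\<^sub>R w j) \<le> r" by simp
      qed
      then have s1: "norm s1 \<le> real N * r" by simp
      have sum_le: "(\<Sum>i<k. \<tau> (N + i) / (2 * real k)) \<le> 1 / 2"
      proof -
        have "(\<Sum>i<k. \<tau> (N + i) / (2 * real k)) \<le> (\<Sum>i<k. 1 / (2 * real k))"
          using \<tau> by (intro sum_mono divide_right_mono) auto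
        then show ?thesis using i by simp
      qed
      have s2: "s2 \<in> K"
        unfolding s2_def using \<tau> sum_le by (intro convex_subunit_combination K v) auto
      have s2v: "s2 + w (N + i) \<in> K"
      proof -
        let ?t = "\<lambda>l. \<tau> (N + l) / (2 * real k) + (if l = i then 1 / (2 * real k) else 0)"
        have "(\<Sum>l<k. ?t l *\<^sub>R v l) \<in> K"
        proof (intro convex_subunit_combination K v)
          have "(\<Sum>l<k. ?t l) \<le> 1 / 2 + 1 / (2 * real k)"
            using sum_le i by (simp add: sum.distrib)
          also have "\<dots> \<le> 1" using i by (simp add: field_simps)
          finally show "(\<Sum>l<k. ?t l) \<le> 1" .
        qed (use \<tau> in auto)
        also have "(\<Sum>l<k. ?t l *\<^sub>R v l) = s2 + w (N + i)"
          using i by (simp add: s2_def w_v scaleR_add_left sum.distrib if_distrib[of "\<lambda>c. c *\<^sub>R _"] cong: if_cong)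
        finally show ?thesis .
      qed
      have dev: "norm (R (s1 + z) - z) \<le> L * (real N * r)" if "z \<in> K" for z
      proof -
        have "norm (R (s1 + z) - z) \<le> L * norm s1"
          using R_norm[of "s1 + z" z] R_id[OF that] by simp
        also have "\<dots> \<le> L * (real N * r)" using s1 lambda_nonneg by (rule mult_left_mono)
        finally show ?thesis .
      qed
      let ?d = "R (s1 + s2 + w (N + i)) - R (s1 + s2)"
      have d: "w (N + i) - ?d = (R (s1 + s2) - s2) - (R (s1 + (s2 + w (N + i))) - (s2 + w (N + i)))"
        by (simp add: add.assoc)
      have "norm (w (N + i) - ?d) \<le> L * (real N * r) + L * (real N * r)"
        unfolding d
        using norm_triangle_ineq4[of "R (s1 + s2) - s2" "R (s1 + (s2 + w (N + i))) - (s2 + w (N + i))"]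
          dev[OF s2] dev[OF s2v] by linarith
      then show "R ((\<Sum>q<N + k. \<tau> q *\<^sub>R w q) + w (N + i)) - R (\<Sum>q<N + k. \<tau> q *\<^sub>R w q)
          \<in> cball (w (N + i)) (2 * L * real N * r)"
        unfolding s by (simp add: dist_norm mult_ac)
    qed (use i in auto)
    then show ?thesis by (simp add: dist_norm norm_minus_commute)
  qed
  show ?thesis
  proof (rule exI[of _ "\<lambda>j. (norm (x j) / r) *\<^sub>R \<Delta> j"],
      rule exI[of _ "\<lambda>i. (2 * real k) *\<^sub>R \<Delta> (N + i)"], intro conjI allI impI)
    fix j assume j: "j < N"
    have "norm ((norm (x j) / r) *\<^sub>R \<Delta> j) = norm (x j) / r * norm (\<Delta> j)" using r by simp
    also have "\<dots> \<le> norm (x j) / r * (L * norm (w j))"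
      using \<Delta>_norm[of j] j r by (intro mult_left_mono) auto
    also have "\<dots> \<le> norm (x j) / r * (L * r)"
      using w_norm[OF j] r lambda_nonneg by (intro mult_left_mono) auto
    also have "\<dots> = L * norm (x j)" using r by simp
    finally show "norm ((norm (x j) / r) *\<^sub>R \<Delta> j) \<le> L * norm (x j)" .
    show "(norm (x j) / r) *\<^sub>R \<Delta> j \<in> near_subspace F (3 * h / r * norm (x j))"
      by (rule near_subspace_scaleR[OF F \<Delta>_near]) (use j r in \<open>simp_all add: mult_ac\<close>)
  next
    fix i assume i: "i < k"
    have "(2 * real k) *\<^sub>R \<Delta> (N + i) - v i = (2 * real k) *\<^sub>R (\<Delta> (N + i) - w (N + i))"
      using i by (simp add: w_v scaleR_diff_right)
    then have "norm ((2 * real k) *\<^sub>R \<Delta> (N + i) - v i) = 2 * real k * norm (\<Delta> (N + i) - w (N + i))"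
      by simp
    also have "\<dots> \<le> 2 * real k * (2 * L * real N * r)" using \<Delta>_v[OF i] by (intro mult_left_mono) auto
    finally show "norm ((2 * real k) *\<^sub>R \<Delta> (N + i) - v i) \<le> 4 * real k * L * real N * r" by simp
    show "(2 * real k) *\<^sub>R \<Delta> (N + i) \<in> near_subspace F (6 * real k * h)"
      by (rule near_subspace_scaleR[OF F \<Delta>_near]) (use i in simp_all)
  next
    fix a c assume eq: "(\<Sum>j<N. a j *\<^sub>R x j) = (\<Sum>i<k. c i *\<^sub>R v i)"
    define C where "C q = (if q < N then a q * (norm (x q) / r) else - (c (q - N) * (2 * real k)))" for q
    have C: "C (N + i) = - (c i * (2 * real k))" for i by (simp add: C_def)
    have "(\<Sum>q<N + k. C q *\<^sub>R w q) = (\<Sum>j<N. a j *\<^sub>R x j) - (\<Sum>i<k. c i *\<^sub>R v i)"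
    proof -
      have "C j *\<^sub>R w j = a j *\<^sub>R x j" if "j < N" for j
        using that r by (cases "x j = 0") (simp_all add: C_def w_x)
      moreover have "C (N + i) *\<^sub>R w (N + i) = - (c i *\<^sub>R v i)" if "i < k" for i
        using that by (simp add: C w_v)
      ultimately show ?thesis by (simp add: sum_lessThan_add sum_negf)
    qed
    then have "(\<Sum>q<N + k. C q *\<^sub>R \<Delta> q) = 0" using rel eq by simp
    moreover have "(\<Sum>q<N + k. C q *\<^sub>R \<Delta> q) =
        (\<Sum>j<N. a j *\<^sub>R (norm (x j) / r) *\<^sub>R \<Delta> j) - (\<Sum>i<k. c i *\<^sub>R (2 * real k) *\<^sub>R \<Delta> (N + i))"
      unfolding sum_lessThan_add C by (simp add: C_def sum_negf)
    ultimately show "(\<Sum>j<N. a j *\<^sub>R (norm (x j) / r) *\<^sub>R \<Delta> j) =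
        (\<Sum>i<k. c i *\<^sub>R (2 * real k) *\<^sub>R \<Delta> (N + i))" by simp
  qed
qed

text \<open>
  The averaged derivative maps \<open>v i\<close> to \<open>v i + \<xi> i\<close> with a small error \<open>\<xi> i\<close>. Subtracting the finite rank
  operator \<open>\<Sum>\<^sub>i g i (\<cdot>) \<xi> i\<close> makes it fix \<open>v i\<close> exactly, and with a suitable \<open>r\<close> this changes the norm by at most 1.
  The price is the factor \<open>N\<close> in \<open>\<eta>\<close>.
\<close>

lemma linearization_fixing_span:
  fixes v x :: "nat \<Rightarrow> 'a" and g :: "nat \<Rightarrow> 'a \<Rightarrow> real" and k N :: nat
  assumes v: "\<And>i. i < k \<Longrightarrow> v i \<in> K" "\<And>i. i < k \<Longrightarrow> v i \<in> F"
    and g: "\<And>i. i < k \<Longrightarrow> linear (g i)" "\<And>i y. i < k \<Longrightarrow> \<bar>g i y\<bar> \<le> c * norm y"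
    and biorth: "\<And>i j. i < k \<Longrightarrow> j < k \<Longrightarrow> g i (v j) = (if i = j then 1 else 0)"
    and c: "0 \<le> c"
    and \<eta>: "\<eta> = h * (12 * (real k)\<^sup>2 * c * L * real N + 3 + 6 * (real k)\<^sup>2 * c)"
  shows "\<exists>D. (\<forall>j<N. norm (D j) \<le> (L + 1) * norm (x j) \<and> D j \<in> near_subspace F (\<eta> * norm (x j))) \<and>
    (\<forall>a. (\<Sum>j<N. a j *\<^sub>R x j) \<in> span (v ` {..<k}) \<longrightarrow> (\<Sum>j<N. a j *\<^sub>R D j) = (\<Sum>j<N. a j *\<^sub>R x j))"
proof -
  \<comment> \<open>Chosen such that the correction has norm at most 1; the summand 1 keeps the denominator positive.\<close>
  define r where "r = 1 / (4 * (real k)\<^sup>2 * c * L * real N + 1)"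
  have pos: "0 < 4 * (real k)\<^sup>2 * c * L * real N + 1"
    using c lambda_nonneg by (simp add: add_nonneg_pos)
  have r: "0 < r" using pos by (simp add: r_def)
  have "\<exists>D E. (\<forall>j<N. norm (D j) \<le> L * norm (x j) \<and> D j \<in> near_subspace F (3 * h / r * norm (x j))) \<and>
    (\<forall>i<k. norm (E i - v i) \<le> 4 * real k * L * real N * r \<and> E i \<in> near_subspace F (6 * real k * h)) \<and>
    (\<forall>a c. (\<Sum>j<N. a j *\<^sub>R x j) = (\<Sum>i<k. c i *\<^sub>R v i) \<longrightarrow>
      (\<Sum>j<N. a j *\<^sub>R D j) = (\<Sum>i<k. c i *\<^sub>R E i))"
    using v(1) r by (rule averaged_derivatives)
  then obtain D E where
    DF: "\<forall>j<N. norm (D j) \<le> L * norm (x j) \<and> D j \<in> near_subspace F (3 * h / r * norm (x j))" and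
    E': "\<forall>i<k. norm (E i - v i) \<le> 4 * real k * L * real N * r \<and> E i \<in> near_subspace F (6 * real k * h)" and
    rel: "\<forall>a c. (\<Sum>j<N. a j *\<^sub>R x j) = (\<Sum>i<k. c i *\<^sub>R v i) \<longrightarrow>
      (\<Sum>j<N. a j *\<^sub>R D j) = (\<Sum>i<k. c i *\<^sub>R E i)"
    by (elim exE conjE)
  have D: "norm (D j) \<le> L * norm (x j)" "D j \<in> near_subspace F (3 * h / r * norm (x j))" if "j < N" for j
    using DF that by simp_all
  have E: "norm (E i - v i) \<le> 4 * real k * L * real N * r" "E i \<in> near_subspace F (6 * real k * h)"
    if "i < k" for i
    using E' that by simp_all
  define \<xi> where "\<xi> i = E i - v i" for i
  define D' where "D' j = D j - (\<Sum>i<k. g i (x j) *\<^sub>R \<xi> i)" for j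
  show ?thesis
  proof (intro exI[of _ D'] conjI allI impI)
    fix j assume j: "j < N"
    have "norm (\<Sum>i<k. g i (x j) *\<^sub>R \<xi> i) \<le> (\<Sum>i<k. (c * norm (x j)) * (4 * real k * L * real N * r))"
    proof (rule sum_norm_le)
      fix i assume "i \<in> {..<k}"
      then show "norm (g i (x j) *\<^sub>R \<xi> i) \<le> (c * norm (x j)) * (4 * real k * L * real N * r)"
        unfolding norm_scaleR \<xi>_def using g(2) E(1) c by (intro mult_mono) auto
    qed
    also have "\<dots> = (4 * (real k)\<^sup>2 * c * L * real N * r) * norm (x j)"
      by (simp add: power2_eq_square)
    also have "\<dots> \<le> 1 * norm (x j)"
      using pos by (intro mult_right_mono) (simp_all add: r_def)
    finally have "norm (D' j) \<le> L * norm (x j) + norm (x j)"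
      using D(1)[OF j] norm_triangle_ineq4[of "D j" "\<Sum>i<k. g i (x j) *\<^sub>R \<xi> i"] by (simp add: D'_def)
    then show "norm (D' j) \<le> (L + 1) * norm (x j)" by (simp add: algebra_simps)
    have \<xi>_near: "\<xi> i \<in> near_subspace F (6 * real k * h)" if "i < k" for i
    proof -
      have "- v i \<in> near_subspace F 0"
        using v(2)[OF that] subspace_neg[OF F] by (auto simp: near_subspace_def intro!: bexI[of _ "- v i"])
      from near_subspace_add[OF F E(2)[OF that] this] show ?thesis by (simp add: \<xi>_def)
    qed
    have "(\<Sum>i<k. (- g i (x j)) *\<^sub>R \<xi> i) \<in> near_subspace F (real k * (c * norm (x j) * (6 * real k * h)))"
    proof (rule near_subspace_sum[OF F])
      fix i assume i: "i < k"
      show "(- g i (x j)) *\<^sub>R \<xi> i \<in> near_subspace F (c * norm (x j) * (6 * real k * h))"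
        using g(2)[OF i, of "x j"] h
        by (intro near_subspace_scaleR[OF F \<xi>_near[OF i]] mult_right_mono) auto
    qed
    from near_subspace_add[OF F D(2)[OF j] this]
    have "D' j \<in> near_subspace F (3 * h / r * norm (x j) + real k * (c * norm (x j) * (6 * real k * h)))"
      by (simp add: D'_def sum_negf)
    also have "3 * h / r * norm (x j) + real k * (c * norm (x j) * (6 * real k * h)) = \<eta> * norm (x j)"
      by (simp add: \<eta> r_def algebra_simps power2_eq_square)
    finally show "D' j \<in> near_subspace F (\<eta> * norm (x j))" .
  next
    fix a
    let ?z = "\<Sum>j<N. a j *\<^sub>R x j"
    assume "?z \<in> span (v ` {..<k})"
    then have z: "?z = (\<Sum>i<k. g i ?z *\<^sub>R v i)"
      using g(1) biorth by (intro biorthogonal_expansion)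
    have "(\<Sum>j<N. a j *\<^sub>R D' j) = (\<Sum>j<N. a j *\<^sub>R D j) - (\<Sum>j<N. \<Sum>i<k. (a j * g i (x j)) *\<^sub>R \<xi> i)"
      by (simp add: D'_def scaleR_diff_right sum_subtractf scaleR_sum_right)
    also have "(\<Sum>j<N. \<Sum>i<k. (a j * g i (x j)) *\<^sub>R \<xi> i) = (\<Sum>i<k. g i ?z *\<^sub>R \<xi> i)"
      by (subst sum.swap) (simp add: linear_sum[OF g(1)] linear_scale[OF g(1)] scaleR_sum_left)
    also have "(\<Sum>j<N. a j *\<^sub>R D j) = (\<Sum>i<k. g i ?z *\<^sub>R E i)"
      by (rule rel[rule_format, of a "\<lambda>i. g i ?z", OF z])
    also have "(\<Sum>i<k. g i ?z *\<^sub>R E i) - (\<Sum>i<k. g i ?z *\<^sub>R \<xi> i) = (\<Sum>i<k. g i ?z *\<^sub>R v i)"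
      by (simp add: \<xi>_def flip: sum_subtractf scaleR_diff_right)
    finally show "(\<Sum>j<N. a j *\<^sub>R D' j) = ?z" using z by simp
  qed
qed

end

section \<open>Operators into a finite-dimensional subspace\<close>

text \<open>
  Tuples of vectors, on which the Hahn-Banach theorem is applied below, are functions with pointwise operations.
\<close>

instantiation "fun" :: (type, real_vector) real_vector
begin

definition "scaleR c f = (\<lambda>x. c *\<^sub>R f x)"

instance
  by standard (auto simp: scaleR_fun_def fun_eq_iff scaleR_add_left scaleR_add_right)

end

lemma scaleR_fun_apply [simp]: "(c *\<^sub>R f) x = c *\<^sub>R f x"
  by (simp add: scaleR_fun_def)

context auerbach_system
begin

definition proj :: "'a \<Rightarrow> 'a" where "proj z = (\<Sum>l<d. f l z *\<^sub>R b l)"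

lemma proj_fixes: "z \<in> F \<Longrightarrow> proj z = z"
  using expand by (simp add: proj_def)

lemma proj_diff: "proj (x - y) = proj x - proj y"
  by (simp add: proj_def linear_diff[OF f_linear] scaleR_diff_left sum_subtractf)

lemma norm_proj_le: "norm (proj z) \<le> 2 * real d * norm z"
proof -
  have "norm (proj z) \<le> (\<Sum>l<d. 2 * norm z)"
    unfolding proj_def
  proof (rule sum_norm_le)
    fix l assume "l \<in> {..<d}"
    then have "\<bar>f l z\<bar> * norm (b l) \<le> (2 * norm z) * 1" by (intro mult_mono f_le b_le) auto
    then show "norm (f l z *\<^sub>R b l) \<le> 2 * norm z" by simp
  qed
  then show ?thesis by (simp add: mult_ac)
qed

text \<open>
  The sum on the left is the trace of \<open>\<Sum>\<^sub>j \<psi>\<^sub>j \<otimes> D j\<close> after projection onto \<open>F\<close>, that is, the sum of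
  the numbers \<open>\<psi>\<^sub>j (proj (D j))\<close>. The projection is harmless on the part of \<open>D j\<close> in \<open>F\<close>, and its norm,
  of order \<open>d\<close>, affects only the small remainder.
\<close>

lemma trace_bound:
  fixes x D :: "nat \<Rightarrow> 'a" and \<psi> :: "nat \<Rightarrow> 'a \<Rightarrow> real"
  assumes \<psi>: "\<And>j. j < N \<Longrightarrow> linear (\<psi> j)" "\<And>j z. j < N \<Longrightarrow> \<bar>\<psi> j z\<bar> \<le> 2 * norm z"
    and D: "\<And>j. j < N \<Longrightarrow> norm (D j) \<le> M * norm (x j)"
    and D_near: "\<And>j. j < N \<Longrightarrow> \<exists>y\<in>F. norm (D j - y) \<le> \<eta> * norm (x j)"
    and \<eta>: "(2 * real d + 1) * \<eta> \<le> 1"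
    and eq: "\<And>l. l < d \<Longrightarrow> (\<Sum>j<N. \<psi> j (b l) *\<^sub>R D j) = z l"
  shows "\<bar>\<Sum>l<d. f l (z l)\<bar> \<le> 2 * (M + 1) * (\<Sum>j<N. norm (x j))"
proof -
  have "(\<Sum>l<d. f l (z l)) = (\<Sum>l<d. \<Sum>j<N. \<psi> j (b l) * f l (D j))"
    by (rule sum.cong) (simp_all add: linear_sum[OF f_linear] linear_scale[OF f_linear] flip: eq)
  also have "\<dots> = (\<Sum>j<N. \<Sum>l<d. \<psi> j (b l) * f l (D j))" by (rule sum.swap)
  also have "\<dots> = (\<Sum>j<N. \<psi> j (proj (D j)))"
    by (rule sum.cong) (simp_all add: proj_def linear_sum[OF \<psi>(1)] linear_scale[OF \<psi>(1)] mult.commute)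
  finally have "\<bar>\<Sum>l<d. f l (z l)\<bar> \<le> (\<Sum>j<N. \<bar>\<psi> j (proj (D j))\<bar>)" by simp
  also have "\<dots> \<le> (\<Sum>j<N. 2 * (M + 1) * norm (x j))"
  proof (rule sum_mono)
    fix j assume "j \<in> {..<N}"
    then have j: "j < N" by simp
    obtain y where y: "y \<in> F" "norm (D j - y) \<le> \<eta> * norm (x j)" using D_near[OF j] by blast
    have "proj (D j) = D j - (D j - y) + proj (D j - y)"
      by (simp add: proj_diff proj_fixes[OF y(1)])
    then have "norm (proj (D j)) \<le> norm (D j) + norm (D j - y) + norm (proj (D j - y))"
      using norm_triangle_ineq[of "D j - (D j - y)" "proj (D j - y)"] norm_triangle_ineq4[of "D j" "D j - y"]
      by simp
    also have "\<dots> \<le> M * norm (x j) + (2 * real d + 1) * norm (D j - y)"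
      using D[OF j] norm_proj_le[of "D j - y"] by (simp add: algebra_simps)
    also have "\<dots> \<le> M * norm (x j) + (2 * real d + 1) * (\<eta> * norm (x j))"
      using y(2) by (intro add_left_mono mult_left_mono) auto
    also have "\<dots> \<le> M * norm (x j) + 1 * norm (x j)"
      using mult_right_mono[OF \<eta> norm_ge_zero[of "x j"]] by (simp add: mult.assoc)
    finally show "\<bar>\<psi> j (proj (D j))\<bar> \<le> 2 * (M + 1) * norm (x j)"
      using \<psi>(2)[OF j, of "proj (D j)"] by (simp add: algebra_simps)
  qed
  also have "\<dots> = 2 * (M + 1) * (\<Sum>j<N. norm (x j))" by (simp add: sum_distrib_left)
  finally show ?thesis .
qed

text \<open>
  An operator \<open>T\<close> into \<open>F\<close> gives the functional \<open>x \<mapsto> \<Sum>\<^sub>j \<psi>\<^sub>j (T (x j))\<close> on tuples, which depends only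
  on the operator \<open>\<Sum>\<^sub>j \<psi>\<^sub>j \<otimes> x j\<close> from \<open>F\<close>, represented by its values \<open>Q l x\<close> at the basis vectors. If \<open>T\<close> is the
  identity on \<open>V\<close>, the functional is the trace \<open>g x\<close> whenever those values lie in \<open>V\<close>. Conversely, the assumed
  trace inequality allows the trace to be extended from these tuples to a functional \<open>\<sigma>\<close> on all tuples,
  bounded by \<open>C\<close> in each entry. On tuples in the kernel of \<open>Q\<close> the trace is 0, so \<open>\<sigma>\<close> still depends only on \<open>Q\<close>
  and comes from an operator \<open>T\<close>. The inclusion of the coordinate functionals \<open>f l\<close> among the \<open>\<psi>\<^sub>j\<close> allows
  the coordinates of \<open>T x\<close> to be read off from tuples with a single nonzero entry.
\<close>

lemma operator_extension:
  fixes \<psi> :: "nat \<Rightarrow> 'a \<Rightarrow> real"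
  assumes V: "subspace V" "V \<subseteq> F" and N: "d \<le> N" and C: "0 \<le> C"
    and \<psi>: "\<And>j. j < N \<Longrightarrow> linear (\<psi> j)" "\<And>j. j < d \<Longrightarrow> \<psi> j = f j"
    and bound: "\<And>x :: nat \<Rightarrow> 'a. (\<And>l. l < d \<Longrightarrow> (\<Sum>j<N. \<psi> j (b l) *\<^sub>R x j) \<in> V) \<Longrightarrow>
      \<bar>\<Sum>l<d. f l (\<Sum>j<N. \<psi> j (b l) *\<^sub>R x j)\<bar> \<le> C * (\<Sum>j<N. norm (x j))"
  shows "\<exists>T. linear T \<and> range T \<subseteq> F \<and> (\<forall>v\<in>V. T v = v) \<and> (\<forall>j<N. \<forall>x. \<bar>\<psi> j (T x)\<bar> \<le> C * norm x)"
proof -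
  define Q where "Q l x = (\<Sum>j<N. \<psi> j (b l) *\<^sub>R x j)" for l and x :: "nat \<Rightarrow> 'a"
  have Q: "linear (Q l)" for l
    by (rule linearI) (simp_all add: Q_def scaleR_add_right sum.distrib scaleR_sum_right mult.commute)
  define W where "W = {x. \<forall>l<d. Q l x \<in> V}"
  define g where "g x = (\<Sum>l<d. f l (Q l x))" for x
  define p where "p x = C * (\<Sum>j<N. norm (x j))" for x :: "nat \<Rightarrow> 'a"
  have W: "subspace W"
    unfolding W_def subspace_def
    using V(1) by (auto simp: linear_0[OF Q] linear_add[OF Q] linear_scale[OF Q]
      intro: subspace_0 subspace_add subspace_scale)
  have p: "sublinear p"
    unfolding sublinear_def
  proof (intro conjI allI impI)
    fix x y :: "nat \<Rightarrow> 'a"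
    have "(\<Sum>j<N. norm ((x + y) j)) \<le> (\<Sum>j<N. norm (x j)) + (\<Sum>j<N. norm (y j))"
      by (simp add: norm_triangle_ineq sum_mono flip: sum.distrib)
    then show "p (x + y) \<le> p x + p y"
      unfolding p_def using C by (metis mult_left_mono distrib_left)
  next
    fix c :: real and x :: "nat \<Rightarrow> 'a" assume "0 \<le> c"
    then show "p (c *\<^sub>R x) = c * p x"
      by (simp add: p_def sum_distrib_left mult_ac)
  qed
  have g_add: "g (x + y) = g x + g y" for x y
    by (simp add: g_def linear_add[OF Q] linear_add[OF f_linear] sum.distrib)
  have g_scale: "g (c *\<^sub>R x) = c * g x" for c x
    by (simp add: g_def linear_scale[OF Q] linear_scale[OF f_linear] sum_distrib_left)
  have g_le: "g x \<le> p x" if "x \<in> W" for x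
    using bound[of x] that by (auto simp: W_def Q_def g_def p_def)
  obtain \<sigma> where \<sigma>: "linear \<sigma>" "\<And>x. \<sigma> x \<le> p x" "\<And>x. x \<in> W \<Longrightarrow> \<sigma> x = g x"
    using hahn_banach[of p W g] p W g_add g_scale g_le by metis
  define \<delta> where "\<delta> j x = (\<lambda>i. if i = j then x else 0)" for j :: nat and x :: 'a
  have \<delta>: "linear (\<delta> j)" for j
    by (rule linearI) (auto simp: \<delta>_def fun_eq_iff)
  have Q_\<delta>: "Q l (\<delta> j x) = \<psi> j (b l) *\<^sub>R x" if "j < N" for l j x
    using that by (simp add: Q_def \<delta>_def if_distrib[of "\<lambda>y. _ *\<^sub>R y"] cong: if_cong)
  have p_\<delta>: "p (\<delta> j x) = C * norm x" if "j < N" for j x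
    using that by (simp add: p_def \<delta>_def if_distrib[of norm] cong: if_cong)
  have \<psi>_b: "\<psi> j (b l) = (if j = l then 1 else 0)" if "j < d" "l < d" for j l
    using that by (simp add: \<psi>(2) biorth)
  define T where "T x = (\<Sum>l<d. \<sigma> (\<delta> l x) *\<^sub>R b l)" for x
  have T: "linear T"
    by (rule linearI) (simp_all add: T_def linear_add[OF \<delta>] linear_scale[OF \<delta>] linear_add[OF \<sigma>(1)]
      linear_scale[OF \<sigma>(1)] scaleR_add_left sum.distrib scaleR_sum_right)
  have "range T \<subseteq> F"
    by (auto simp: T_def intro!: subspace_sum[OF F] subspace_scale[OF F] b_in)
  moreover have "T v = v" if v: "v \<in> V" for v
  proof -
    have "\<sigma> (\<delta> l v) = f l v" if l: "l < d" for l
    proof -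
      have Ql: "Q m (\<delta> l v) = (if l = m then v else 0)" if "m < d" for m
        using Q_\<delta>[of l m v] l that N \<psi>_b by simp
      have "\<delta> l v \<in> W" using v subspace_0[OF V(1)] by (auto simp: W_def Ql)
      then have "\<sigma> (\<delta> l v) = g (\<delta> l v)" by (rule \<sigma>(3))
      also have "\<dots> = (\<Sum>m<d. if m = l then f l v else 0)"
        unfolding g_def by (rule sum.cong) (auto simp: Ql linear_0[OF f_linear])
      finally show ?thesis using l by simp
    qed
    then have "T v = (\<Sum>l<d. f l v *\<^sub>R b l)" by (simp add: T_def)
    then show ?thesis using expand v V(2) by auto
  qed
  moreover have "\<bar>\<psi> j (T x)\<bar> \<le> C * norm x" if j: "j < N" for j x
  proof -
    \<comment> \<open>The tuples \<open>\<delta> j x\<close> and \<open>\<Sum>\<^sub>l \<psi>\<^sub>j (b l) \<delta> l x\<close> represent the same operator \<open>\<psi>\<^sub>j \<otimes> x\<close>.\<close>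
    define y where "y = \<delta> j x - (\<Sum>l<d. \<psi> j (b l) *\<^sub>R \<delta> l x)"
    have Qy: "Q m y = 0" if m: "m < d" for m
    proof -
      have "(\<Sum>l<d. \<psi> j (b l) *\<^sub>R Q m (\<delta> l x)) = (\<Sum>l<d. if l = m then \<psi> j (b m) *\<^sub>R x else 0)"
        using N by (intro sum.cong) (auto simp: Q_\<delta> \<psi>_b m)
      then show ?thesis
        using m Q_\<delta>[OF j, of m x]
        by (simp add: y_def linear_diff[OF Q] linear_sum[OF Q] linear_scale[OF Q])
    qed
    have "y \<in> W" using Qy subspace_0[OF V(1)] by (simp add: W_def)
    then have "\<sigma> y = g y" by (rule \<sigma>(3))
    also have "g y = 0" by (simp add: g_def Qy linear_0[OF f_linear])
    finally have "\<sigma> (\<delta> j x) = (\<Sum>l<d. \<psi> j (b l) * \<sigma> (\<delta> l x))"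
      by (simp add: y_def linear_diff[OF \<sigma>(1)] linear_sum[OF \<sigma>(1)] linear_scale[OF \<sigma>(1)])
    also have "\<dots> = \<psi> j (T x)"
      by (simp add: T_def linear_sum[OF \<psi>(1)[OF j]] linear_scale[OF \<psi>(1)[OF j]] mult.commute)
    finally have *: "\<psi> j (T x) = \<sigma> (\<delta> j x)" by simp
    have "\<sigma> (\<delta> j x) \<le> C * norm x" using \<sigma>(2) p_\<delta>[OF j] by metis
    moreover have "- \<sigma> (\<delta> j x) \<le> C * norm x"
      using \<sigma>(2)[of "\<delta> j (- x)"] p_\<delta>[OF j, of "- x"] linear_neg[OF \<delta>] linear_neg[OF \<sigma>(1)] by simp
    ultimately show ?thesis unfolding * by (rule abs_leI)
  qed
  ultimately show ?thesis using T by blast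
qed

end

text \<open>
  Norming functionals for \<open>span B\<close> together with the coordinate functionals form the family \<open>\<psi>\<close> for the extension
  argument; the maps \<open>D\<close> need to be available only for as many vectors as there are functionals.
\<close>

lemma fixing_operator_exists:
  fixes B V :: "'a::real_normed_vector set"
  assumes B: "finite B" "independent B" and V: "subspace V" "V \<subseteq> span B" and M: "0 \<le> M"
    and s: "0 < s" "s < 1" "2 * s / (1 - s) < \<theta>" "\<theta> < 1"
    and \<eta>: "(2 * real (card B) + 1) * \<eta> \<le> 1"
    and lin: "\<And>(x :: nat \<Rightarrow> 'a) N. real N \<le> (1 / s) ^ card B + card B \<Longrightarrow>
      \<exists>D. (\<forall>j<N. norm (D j) \<le> M * norm (x j) \<and> (\<exists>y\<in>span B. norm (D j - y) \<le> \<eta> * norm (x j))) \<and>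
        (\<forall>a. (\<Sum>j<N. a j *\<^sub>R x j) \<in> V \<longrightarrow> (\<Sum>j<N. a j *\<^sub>R D j) = (\<Sum>j<N. a j *\<^sub>R x j))"
  shows "\<exists>T. linear T \<and> range T \<subseteq> span B \<and> (\<forall>v\<in>V. T v = v) \<and>
    (\<forall>x. norm (T x) \<le> 2 * (M + 1) / (1 - \<theta>) * norm x)"
proof -
  define d where "d = card B"
  obtain b f where "auerbach_system (span B) d b f"
    using auerbach_system_exists[OF B] unfolding d_def by blast
  then interpret auerbach_system "span B" d b f .
  have "\<exists>n \<phi>. real n \<le> (1 / s) ^ card B \<and> (\<forall>j<n. linear (\<phi> j) \<and> (\<forall>x. \<bar>\<phi> j x\<bar> \<le> norm x)) \<and>
      (\<forall>x\<in>span B. x \<noteq> 0 \<longrightarrow> (\<exists>j<n. (1 - \<theta>) * norm x \<le> \<phi> j x))"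
    using few_norming_functionals[OF B s(1-3)] by metis
  then obtain n \<phi> where n: "real n \<le> (1 / s) ^ card B"
    and \<phi>: "\<forall>j<n. linear (\<phi> j) \<and> (\<forall>x. \<bar>\<phi> j x\<bar> \<le> norm x)"
    and norming: "\<forall>x\<in>span B. x \<noteq> 0 \<longrightarrow> (\<exists>j<n. (1 - \<theta>) * norm x \<le> \<phi> j x)"
    by (elim exE conjE)
  define N where "N = d + n"
  define \<psi> where "\<psi> j = (if j < d then f j else \<phi> (j - d))" for j
  have \<psi>_lin: "linear (\<psi> j)" if "j < N" for j
    using that \<phi> f_linear by (auto simp: \<psi>_def N_def)
  have \<psi>_le: "\<bar>\<psi> j z\<bar> \<le> 2 * norm z" if "j < N" for j z
  proof (cases "j < d")
    case False
    then have "\<bar>\<phi> (j - d) z\<bar> \<le> norm z" using that \<phi> by (simp add: N_def)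
    then show ?thesis using False norm_ge_zero[of z] unfolding \<psi>_def by simp
  qed (simp add: \<psi>_def f_le)
  have "\<bar>\<Sum>l<d. f l (\<Sum>j<N. \<psi> j (b l) *\<^sub>R x j)\<bar> \<le> 2 * (M + 1) * (\<Sum>j<N. norm (x j))"
    if x: "\<And>l. l < d \<Longrightarrow> (\<Sum>j<N. \<psi> j (b l) *\<^sub>R x j) \<in> V" for x
  proof -
    have "real N \<le> (1 / s) ^ card B + card B" using n by (simp add: N_def d_def)
    from lin[OF this, of x] obtain D where
      D: "\<forall>j<N. norm (D j) \<le> M * norm (x j) \<and> (\<exists>y\<in>span B. norm (D j - y) \<le> \<eta> * norm (x j))"
      and eq: "\<forall>a. (\<Sum>j<N. a j *\<^sub>R x j) \<in> V \<longrightarrow> (\<Sum>j<N. a j *\<^sub>R D j) = (\<Sum>j<N. a j *\<^sub>R x j)"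
      by (elim exE conjE)
    show ?thesis
    proof (rule trace_bound[OF \<psi>_lin \<psi>_le])
      show "(2 * real d + 1) * \<eta> \<le> 1" using \<eta> by (simp add: d_def)
      show "(\<Sum>j<N. \<psi> j (b l) *\<^sub>R D j) = (\<Sum>j<N. \<psi> j (b l) *\<^sub>R x j)" if "l < d" for l
        by (rule eq[rule_format, OF x[OF that]])
    qed (use D in auto)
  qed
  then have "\<exists>T. linear T \<and> range T \<subseteq> span B \<and> (\<forall>v\<in>V. T v = v) \<and>
      (\<forall>j<N. \<forall>x. \<bar>\<psi> j (T x)\<bar> \<le> 2 * (M + 1) * norm x)"
    using M by (intro operator_extension V \<psi>_lin) (auto simp: N_def \<psi>_def)
  then obtain T where T: "linear T" "range T \<subseteq> span B" "\<forall>v\<in>V. T v = v"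
    and \<psi>T: "\<forall>j<N. \<forall>x. \<bar>\<psi> j (T x)\<bar> \<le> 2 * (M + 1) * norm x" by (elim exE conjE)
  have "norm (T x) \<le> 2 * (M + 1) / (1 - \<theta>) * norm x" for x
  proof (cases "T x = 0")
    case True
    then show ?thesis using M s(4) by simp
  next
    case False
    then obtain j where j: "j < n" "(1 - \<theta>) * norm (T x) \<le> \<phi> j (T x)"
      using norming T(2) by blast
    have "\<phi> j (T x) \<le> 2 * (M + 1) * norm x"
      using \<psi>T[rule_format, of "d + j" x] j(1) by (simp add: N_def \<psi>_def)
    then show ?thesis using j(2) s(4) by (simp add: field_simps)
  qed
  with T show ?thesis by blast
qed

section \<open>Flat sets and the bounded approximation property\<close>

lemma finite_dimensional_operator_finite_rank:
  fixes T :: "'a::real_normed_vector \<Rightarrow>\<^sub>L 'b::real_normed_vector"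
  assumes B: "finite B" and T: "range (blinfun_apply T) \<subseteq> span B"
  shows "finite_rank T"
proof -
  have sub: "subspace (range (blinfun_apply T))"
    using subspace_UNIV by (rule linear_subspace_image[OF bounded_linear.linear[OF blinfun.bounded_linear_right]])
  obtain C where C: "C \<subseteq> range (blinfun_apply T)" "independent C" "range (blinfun_apply T) \<subseteq> span C"
    using basis_exists[of "range (blinfun_apply T)"] by metis
  have "C \<subseteq> span B" using C(1) T by (rule order_trans)
  then have "finite C" using independent_span_bound[OF B C(2)] by simp
  moreover have "span C \<subseteq> range (blinfun_apply T)" using C(1) sub by (rule span_minimal)
  ultimately show ?thesis using C(3) unfolding finite_rank_def by (metis antisym)
qed

lemma polynomial_times_power_eventually_le:
  fixes \<mu> \<kappa> a c :: real and m :: nat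
  assumes \<mu>: "2 \<le> \<mu>" "\<mu> < \<kappa>" and ac: "0 \<le> a" "0 \<le> c"
  shows "\<forall>\<^sub>F n in sequentially.
    (2 * real (n + m) + 1) * (a * (\<mu> ^ (n + m) + real (n + m)) + c) \<le> \<kappa> ^ n"
proof -
  define x where "x = \<mu> / \<kappa>"
  define C where "C = (2 * a + c) * \<mu> ^ m"
  have x: "norm x < 1" using \<mu> by (simp add: x_def)
  have "(\<lambda>n. C * (2 * (real n * x ^ n) + (2 * real m + 1) * x ^ n)) \<longlonglongrightarrow> C * (2 * 0 + (2 * real m + 1) * 0)"
    by (intro tendsto_intros powser_times_n_limit_0 LIMSEQ_power_zero x)
  then have "\<forall>\<^sub>F n in sequentially. C * (2 * (real n * x ^ n) + (2 * real m + 1) * x ^ n) < 1"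
    by (rule order_tendstoD(2)) simp
  then show ?thesis
  proof eventually_elim
    case (elim n)
    have \<kappa>: "0 < \<kappa> ^ n" using \<mu> by simp
    have "real (n + m) < 2 ^ (n + m)" by (rule of_nat_less_two_power)
    also have "\<dots> \<le> \<mu> ^ (n + m)" using \<mu> by (intro power_mono) auto
    finally have nm: "real (n + m) \<le> \<mu> ^ (n + m)" by simp
    have one: "1 \<le> \<mu> ^ (n + m)" using \<mu> by simp
    have "a * (\<mu> ^ (n + m) + real (n + m)) + c \<le> a * (\<mu> ^ (n + m) + \<mu> ^ (n + m)) + c * \<mu> ^ (n + m)"
      using nm ac mult_left_mono[OF one ac(2)] by (intro add_mono mult_left_mono) auto
    also have "\<dots> = (2 * a + c) * \<mu> ^ (n + m)" by (simp add: algebra_simps)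
    finally have "(2 * real (n + m) + 1) * (a * (\<mu> ^ (n + m) + real (n + m)) + c)
        \<le> (2 * real (n + m) + 1) * ((2 * a + c) * \<mu> ^ (n + m))"
      by (intro mult_left_mono) auto
    also have "\<dots> = C * (2 * real n + (2 * real m + 1)) * \<mu> ^ n"
      by (simp add: C_def power_add algebra_simps)
    also have "\<mu> ^ n = x ^ n * \<kappa> ^ n" using \<mu> by (simp add: x_def power_divide)
    also have "C * (2 * real n + (2 * real m + 1)) * (x ^ n * \<kappa> ^ n)
        = (C * (2 * (real n * x ^ n) + (2 * real m + 1) * x ^ n)) * \<kappa> ^ n"
      by (simp add: algebra_simps)
    also have "\<dots> \<le> 1 * \<kappa> ^ n" using elim \<kappa> by (intro mult_right_mono) auto
    finally show ?case by simp
  qed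
qed

lemma infdist_le_height:
  assumes K: "bounded K" and x: "x \<in> K"
  shows "infdist x (span (e ` {1..n})) \<le> height e K n"
proof -
  obtain b where b: "\<And>y. y \<in> K \<Longrightarrow> norm y \<le> b" using K by (auto simp: bounded_iff)
  have "bdd_above ((\<lambda>y. infdist y (span (e ` {1..n}))) ` K)"
  proof (rule bdd_aboveI2)
    fix y assume "y \<in> K"
    then show "infdist y (span (e ` {1..n})) \<le> b"
      using infdist_le[OF span_zero, of y "e ` {1..n}"] b[of y] by simp
  qed
  then show ?thesis unfolding height_def using x by (rule cSUP_upper2) simp
qed

lemma frequently_small_height:
  assumes "liminf (\<lambda>n. ereal (height e K n * \<kappa> ^ n)) = 0"
  shows "\<exists>\<^sub>F n in sequentially. height e K n * \<kappa> ^ n < 1 / 2"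
proof (rule ccontr)
  assume "\<not> ?thesis"
  then have "\<forall>\<^sub>F n in sequentially. ereal (1 / 2) \<le> ereal (height e K n * \<kappa> ^ n)"
    by (simp add: not_frequently not_less)
  then have "ereal (1 / 2) \<le> 0"
    using Liminf_bounded assms by metis
  then show False by simp
qed

text \<open>
  The bound on the norm depends on the Lipschitz constant and \<open>\<theta>\<close> alone. For \<open>\<mu> = 3 + \<epsilon> / 2\<close> there
  are at most about \<open>\<mu> ^ n\<close> norming functionals up to a constant factor, so the errors in the linearisation are
  \<open>h\<^sub>n\<close> times a quantity that is eventually smaller than \<open>(3 + \<epsilon>) ^ n\<close>, even after multiplication by the dimension.
\<close>

lemma operator_fixing_finite_subset:
  fixes K S :: "'a::banach set"
  assumes K: "convex K" "0 \<in> K" "bounded K"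
    and R: "\<And>x. R x \<in> K" "\<And>x. x \<in> K \<Longrightarrow> R x = x" "L-lipschitz_on UNIV R"
    and flat: "0 < \<epsilon>" "liminf (\<lambda>n. ereal (height e K n * (3 + \<epsilon>) ^ n)) = 0"
    and \<theta>: "2 / (2 + \<epsilon> / 2) < \<theta>" "\<theta> < 1"
    and S: "finite S" "S \<subseteq> K"
  shows "\<exists>T. finite_rank T \<and> norm T \<le> 2 * (L + 2) / (1 - \<theta>) \<and> (\<forall>x\<in>span S. blinfun_apply T x = x)"
proof -
  have L: "0 \<le> L" using R(3) by (rule lipschitz_on_nonneg)
  obtain B0 where B0: "B0 \<subseteq> S" "independent B0" "S \<subseteq> span B0"
    using maximal_independent_subset[of S] by metis
  have B0_fin: "finite B0" using B0(1) S(1) by (rule finite_subset)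
  define k where "k = card B0"
  obtain v where v: "bij_betw v {..<k} B0"
    using bij_betw_from_nat_into_finite[OF B0_fin] k_def by blast
  have v_in: "v i \<in> B0" if "i < k" for i using v that by (auto simp: bij_betw_def)
  obtain g0 where g0: "\<forall>b\<in>B0. bounded_linear (g0 b) \<and> (\<forall>c\<in>B0. g0 b c = (if b = c then 1 else 0 :: real))"
    using biorthogonal_functionals[OF B0_fin B0(2)] by (elim exE)
  define g where "g i = g0 (v i)" for i
  have g_bl: "bounded_linear (g i)" if "i < k" for i using g0 v_in[OF that] by (simp add: g_def)
  define c where "c = (\<Sum>i<k. onorm (g i))"
  have c: "0 \<le> c" unfolding c_def using g_bl by (intro sum_nonneg) (simp add: onorm_pos_le)
  have g_le: "\<bar>g i y\<bar> \<le> c * norm y" if i: "i < k" for i y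
  proof -
    have "\<bar>g i y\<bar> \<le> onorm (g i) * norm y" using onorm[OF g_bl[OF i], of y] by simp
    also have "\<dots> \<le> c * norm y"
      unfolding c_def using i g_bl by (intro mult_right_mono member_le_sum) (auto simp: onorm_pos_le)
    finally show ?thesis .
  qed
  have g_biorth: "g i (v j) = (if i = j then 1 else 0)" if "i < k" "j < k" for i j
    using g0 v_in[OF that(1)] v_in[OF that(2)] that
      inj_on_eq_iff[OF bij_betw_imp_inj_on[OF v], of i j] by (simp add: g_def)
  define \<mu> where "\<mu> = 3 + \<epsilon> / 2"
  define \<alpha> where "\<alpha> = 12 * (real k)\<^sup>2 * c * L"
  define \<gamma> where "\<gamma> = 3 + 6 * (real k)\<^sup>2 * c"
  have nonneg: "0 \<le> \<alpha>" "0 \<le> \<gamma>" using c L by (simp_all add: \<alpha>_def \<gamma>_def)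
  define m where "m = card S"
  have "\<forall>\<^sub>F n in sequentially.
      (2 * real (n + m) + 1) * (\<alpha> * (\<mu> ^ (n + m) + real (n + m)) + \<gamma>) \<le> (3 + \<epsilon>) ^ n"
    using flat(1) nonneg by (intro polynomial_times_power_eventually_le) (auto simp: \<mu>_def)
  with frequently_small_height[OF flat(2)]
  have "\<exists>\<^sub>F n in sequentially. height e K n * (3 + \<epsilon>) ^ n < 1 / 2 \<and>
      (2 * real (n + m) + 1) * (\<alpha> * (\<mu> ^ (n + m) + real (n + m)) + \<gamma>) \<le> (3 + \<epsilon>) ^ n"
    by (rule frequently_eventually_frequently)
  then obtain n where n: "height e K n * (3 + \<epsilon>) ^ n < 1 / 2"
      "(2 * real (n + m) + 1) * (\<alpha> * (\<mu> ^ (n + m) + real (n + m)) + \<gamma>) \<le> (3 + \<epsilon>) ^ n"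
    by (auto dest: frequently_ex)
  define Z where "Z = e ` {1..n} \<union> S"
  have Z_fin: "finite Z" using S(1) by (simp add: Z_def)
  obtain B where B: "B \<subseteq> Z" "independent B" "Z \<subseteq> span B"
    using maximal_independent_subset[of Z] by metis
  have B_fin: "finite B" using B(1) Z_fin by (rule finite_subset)
  have "card B \<le> card Z" using Z_fin B(1) by (rule card_mono)
  also have "\<dots> \<le> card (e ` {1..n}) + m" unfolding Z_def m_def by (rule card_Un_le)
  also have "card (e ` {1..n}) \<le> n" using card_image_le[of "{1..n}" e] by simp
  finally have card_B: "card B \<le> n + m" by simp
  have E_F: "span (e ` {1..n}) \<subseteq> span B"
    using B(3) by (intro span_minimal subspace_span) (auto simp: Z_def)
  have S_F: "S \<subseteq> span B" using B(3) by (auto simp: Z_def)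
  \<comment> \<open>The height plus a margin, since the distance to \<open>F\<close> is an infimum and a positive \<open>h\<close> is required.\<close>
  define h where "h = height e K n + 1 / (2 * (3 + \<epsilon>) ^ n)"
  have pow: "0 < (3 + \<epsilon>) ^ n" using flat(1) by simp
  have height_less: "height e K n < h" using pow by (simp add: h_def)
  have "0 \<le> height e K n"
    using infdist_le_height[OF K(3,2), of e n] infdist_nonneg order_trans by metis
  then have h: "0 < h" using height_less by simp
  have "h * (3 + \<epsilon>) ^ n = height e K n * (3 + \<epsilon>) ^ n + 1 / 2"
    using flat(1) by (simp add: h_def field_simps)
  then have h_pow: "h * (3 + \<epsilon>) ^ n \<le> 1" using n(1) by simp
  have near: "K \<subseteq> near_subspace (span B) h"
  proof
    fix x assume "x \<in> K"
    have "infdist x (span (e ` {1..n})) < h"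
      using infdist_le_height[OF K(3) \<open>x \<in> K\<close>] height_less by (rule le_less_trans)
    moreover have nonempty: "span (e ` {1..n}) \<noteq> {}" using span_zero[of "e ` {1..n}"] by auto
    ultimately have "(INF y\<in>span (e ` {1..n}). dist x y) < h" by (simp add: infdist_notempty)
    then obtain y where y: "y \<in> span (e ` {1..n})" "dist x y < h"
      using cInf_lessD[of "dist x ` span (e ` {1..n})" h] nonempty by auto
    have "norm (x - y) \<le> h" using y(2) by (simp add: dist_norm)
    with y(1) E_F show "x \<in> near_subspace (span B) h" by (intro near_subspaceI) auto
  qed
  interpret retraction_near_subspace K "span B" R L h
    by unfold_locales (use K R h near in auto)
  define Nmax where "Nmax = \<mu> ^ card B + real (card B)"
  define \<eta> where "\<eta> = h * (\<alpha> * Nmax + \<gamma>)"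
  have \<mu>: "1 \<le> \<mu>" using flat(1) by (simp add: \<mu>_def)
  have "(2 * real (card B) + 1) * (\<alpha> * Nmax + \<gamma>)
      \<le> (2 * real (n + m) + 1) * (\<alpha> * (\<mu> ^ (n + m) + real (n + m)) + \<gamma>)"
    unfolding Nmax_def using card_B nonneg \<mu>
    by (intro mult_mono add_mono mult_left_mono power_increasing) auto
  also have "\<dots> \<le> (3 + \<epsilon>) ^ n" by (rule n(2))
  finally have "h * ((2 * real (card B) + 1) * (\<alpha> * Nmax + \<gamma>)) \<le> h * (3 + \<epsilon>) ^ n"
    using h by (intro mult_left_mono) auto
  then have \<eta>_le: "(2 * real (card B) + 1) * \<eta> \<le> 1"
    using h_pow by (simp add: \<eta>_def mult_ac)
  have lin: "\<exists>D. (\<forall>j<N. norm (D j) \<le> (L + 1) * norm (x j) \<and>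
        (\<exists>y\<in>span B. norm (D j - y) \<le> \<eta> * norm (x j))) \<and>
      (\<forall>a. (\<Sum>j<N. a j *\<^sub>R x j) \<in> span B0 \<longrightarrow> (\<Sum>j<N. a j *\<^sub>R D j) = (\<Sum>j<N. a j *\<^sub>R x j))"
    if N: "real N \<le> (1 / (1 / \<mu>)) ^ card B + card B" for N and x :: "nat \<Rightarrow> 'a"
  proof -
    define \<eta>' where "\<eta>' = h * (12 * (real k)\<^sup>2 * c * L * real N + 3 + 6 * (real k)\<^sup>2 * c)"
    have "\<eta>' = h * (\<alpha> * real N + \<gamma>)" by (simp add: \<eta>'_def \<alpha>_def \<gamma>_def)
    also have "\<dots> \<le> \<eta>"
      unfolding \<eta>_def Nmax_def using N h nonneg by (intro mult_left_mono add_right_mono) auto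
    finally have \<eta>': "\<eta>' \<le> \<eta>" .
    have "\<exists>D. (\<forall>j<N. norm (D j) \<le> (L + 1) * norm (x j) \<and> D j \<in> near_subspace (span B) (\<eta>' * norm (x j))) \<and>
      (\<forall>a. (\<Sum>j<N. a j *\<^sub>R x j) \<in> span (v ` {..<k}) \<longrightarrow> (\<Sum>j<N. a j *\<^sub>R D j) = (\<Sum>j<N. a j *\<^sub>R x j))"
    proof (rule linearization_fixing_span[where g = g and c = c])
      show "v i \<in> K" "v i \<in> span B" if "i < k" for i
        using v_in[OF that] B0(1) S(2) S_F by auto
      show "linear (g i)" if "i < k" for i using g_bl[OF that] by (rule bounded_linear.linear)
    qed (use g_le g_biorth c \<eta>'_def in auto)
    then obtain D where D: "\<forall>j<N. norm (D j) \<le> (L + 1) * norm (x j) \<and> D j \<in> near_subspace (span B) (\<eta>' * norm (x j))"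
      and eq: "\<forall>a. (\<Sum>j<N. a j *\<^sub>R x j) \<in> span (v ` {..<k}) \<longrightarrow> (\<Sum>j<N. a j *\<^sub>R D j) = (\<Sum>j<N. a j *\<^sub>R x j)"
      by (elim exE conjE)
    have vB0: "v ` {..<k} = B0" using v by (simp add: bij_betw_def)
    have "\<exists>y\<in>span B. norm (D j - y) \<le> \<eta> * norm (x j)" if j: "j < N" for j
    proof -
      obtain y where y: "y \<in> span B" "norm (D j - y) \<le> \<eta>' * norm (x j)"
        using D[rule_format, OF j] by (auto simp: near_subspace_def)
      have "\<eta>' * norm (x j) \<le> \<eta> * norm (x j)" using \<eta>' by (rule mult_right_mono) simp
      with y show ?thesis by (meson order_trans)
    qed
    with D eq show ?thesis unfolding vB0 by (intro exI[of _ D]) simp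
  qed
  have "\<exists>T. linear T \<and> range T \<subseteq> span B \<and> (\<forall>x\<in>span B0. T x = x) \<and>
      (\<forall>x. norm (T x) \<le> 2 * ((L + 1) + 1) / (1 - \<theta>) * norm x)"
  proof (rule fixing_operator_exists[OF B_fin B(2) subspace_span _ _ _ _ _ \<theta>(2) \<eta>_le lin])
    show "span B0 \<subseteq> span B" using B0(1) S_F by (intro span_minimal subspace_span) auto
    show "0 \<le> L + 1" using L by simp
    show "0 < 1 / \<mu>" "1 / \<mu> < 1" using flat(1) by (simp_all add: \<mu>_def)
    show "2 * (1 / \<mu>) / (1 - 1 / \<mu>) < \<theta>"
    proof -
      have "1 - 1 / \<mu> = (\<mu> - 1) / \<mu>" using \<mu> by (simp add: diff_divide_distrib)
      then have "2 * (1 / \<mu>) / (1 - 1 / \<mu>) = 2 / (\<mu> - 1)" using \<mu> by simp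
      also have "\<mu> - 1 = 2 + \<epsilon> / 2" by (simp add: \<mu>_def)
      finally show ?thesis using \<theta>(1) by simp
    qed
  qed
  then obtain T where T: "linear T" "range T \<subseteq> span B" "\<forall>x\<in>span B0. T x = x"
    and T_le: "\<forall>x. norm (T x) \<le> 2 * ((L + 1) + 1) / (1 - \<theta>) * norm x" by (elim exE conjE)
  have bl: "bounded_linear T"
    using T(1) T_le by (intro bounded_linear_intro[where K = "2 * ((L + 1) + 1) / (1 - \<theta>)"])
      (auto simp: linear_iff mult.commute)
  show ?thesis
  proof (intro exI[of _ "Blinfun T"] conjI ballI)
    show "finite_rank (Blinfun T)"
      using B_fin T(2) by (intro finite_dimensional_operator_finite_rank) (simp_all add: bounded_linear_Blinfun_apply[OF bl])
    show "norm (Blinfun T) \<le> 2 * (L + 2) / (1 - \<theta>)"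
      using T_le L \<theta>(2) by (intro norm_blinfun_bound) (simp_all add: bounded_linear_Blinfun_apply[OF bl] add_ac)
    fix x assume "x \<in> span S"
    moreover have "span S \<subseteq> span B0" using B0(3) by (intro span_minimal subspace_span)
    ultimately show "blinfun_apply (Blinfun T) x = x"
      using T(3) by (auto simp: bounded_linear_Blinfun_apply[OF bl])
  qed
qed

lemma BAP_of_operators_fixing_finite_subsets:
  fixes K :: "'a::real_normed_vector set"
  assumes K: "generating K"
    and ex: "\<And>S. finite S \<Longrightarrow> S \<subseteq> K \<Longrightarrow>
      \<exists>T. finite_rank T \<and> norm T \<le> M \<and> (\<forall>x\<in>span S. blinfun_apply T x = (x :: 'a))"
  shows "bounded_approximation_property TYPE('a)"
proof -
  define I where "I = {S. finite S \<and> S \<subseteq> K}"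
  have "\<forall>S. \<exists>T. S \<in> I \<longrightarrow> finite_rank T \<and> norm T \<le> M \<and> (\<forall>x\<in>span S. blinfun_apply T x = x)"
    using ex by (auto simp: I_def)
  then obtain T where T: "\<forall>S. S \<in> I \<longrightarrow> finite_rank (T S) \<and> norm (T S) \<le> M \<and>
      (\<forall>x\<in>span S. blinfun_apply (T S) x = x)"
    using choice by metis
  have "{} \<in> I" by (simp add: I_def)
  then have M: "0 \<le> M" using T norm_ge_zero order_trans by metis
  have "directed_on I (\<subseteq>)"
    unfolding directed_on_def
  proof (intro conjI ballI)
    show "I \<noteq> {}" using \<open>{} \<in> I\<close> by auto
    show "reflp_on I (\<subseteq>)" by (auto simp: reflp_on_def)
    show "transp_on I (\<subseteq>)" by (auto simp: transp_on_def)
    fix S S' assume "S \<in> I" "S' \<in> I"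
    then show "\<exists>U\<in>I. S \<subseteq> U \<and> S' \<subseteq> U" by (intro bexI[of _ "S \<union> S'"]) (auto simp: I_def)
  qed
  moreover have "net_tendsto I (\<subseteq>) (\<lambda>S. blinfun_apply (T S) x) x" for x
    unfolding net_tendsto_def
  proof (intro allI impI)
    fix \<epsilon> :: real assume \<epsilon>: "0 < \<epsilon>"
    have "x \<in> closure (span K)" using K by (simp add: generating_def)
    moreover have "0 < \<epsilon> / (M + 1)" using \<epsilon> M by simp
    ultimately obtain y where y: "y \<in> span K" "dist y x < \<epsilon> / (M + 1)"
      unfolding closure_approachable by blast
    obtain S0 r where S0: "finite S0" "S0 \<subseteq> K" "y = (\<Sum>a\<in>S0. r a *\<^sub>R a)"
      using y(1) unfolding span_explicit by auto
    have "y \<in> span S0" unfolding S0(3) by (intro span_sum span_scale span_base)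
    have "norm (blinfun_apply (T S) x - x) < \<epsilon>" if S: "S \<in> I" "S0 \<subseteq> S" for S
    proof -
      have "y \<in> span S" using \<open>y \<in> span S0\<close> span_mono[OF S(2)] by auto
      then have Ty: "blinfun_apply (T S) y = y" using T S(1) by simp
      have "blinfun_apply (T S) x - x = blinfun_apply (T S) (x - y) - (x - y)"
        by (simp add: blinfun.diff_right Ty)
      also have "norm \<dots> \<le> norm (T S) * norm (x - y) + norm (x - y)"
        using norm_triangle_ineq4[of "blinfun_apply (T S) (x - y)" "x - y"] norm_blinfun[of "T S" "x - y"]
        by linarith
      also have "\<dots> \<le> M * norm (x - y) + norm (x - y)"
        using T S(1) by (intro add_right_mono mult_right_mono) auto
      also have "\<dots> = (M + 1) * norm (x - y)" by (simp add: algebra_simps)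
      also have "\<dots> < \<epsilon>" using y(2) M by (simp add: dist_norm norm_minus_commute field_simps)
      finally show ?thesis .
    qed
    with S0 show "\<exists>S\<in>I. \<forall>S'\<in>I. S \<subseteq> S' \<longrightarrow> norm (blinfun_apply (T S') x - x) < \<epsilon>"
      by (intro bexI[of _ S0]) (auto simp: I_def)
  qed
  ultimately have "approximating_net I (\<subseteq>) T"
    using T unfolding approximating_net_def by blast
  then show ?thesis by (rule approximating_net_imp_BAP)
qed

theorem corollary2p8:
  fixes K :: "'a::banach set"
  assumes "separable_space (euclidean :: 'a topology)"
    and "generating K" and "convex K" and "flat K" and "0 \<in> K"
    and "\<exists>R. lipschitz_retraction K R"
  shows "bounded_approximation_property TYPE('a)"
proof -
  obtain R L where R: "\<And>x. R x \<in> K" "\<And>x. x \<in> K \<Longrightarrow> R x = x" "L-lipschitz_on UNIV R"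
    using assms(6) by (auto simp: lipschitz_retraction_def)
  obtain e \<epsilon> where K: "bounded K" and \<epsilon>: "0 < \<epsilon>"
    and flat: "liminf (\<lambda>n. ereal (height e K n * (3 + \<epsilon>) ^ n)) = 0"
    using assms(4) by (auto simp: flat_def beta_flat_def)
  have "2 / (2 + \<epsilon> / 2) < 1" using \<epsilon> by (simp add: field_simps)
  then obtain \<theta> where \<theta>: "2 / (2 + \<epsilon> / 2) < \<theta>" "\<theta> < 1" using dense by blast
  show ?thesis
    using assms(2) operator_fixing_finite_subset[OF assms(3,5) K R \<epsilon> flat \<theta>]
    by (rule BAP_of_operators_fixing_finite_subsets)
qed

end
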